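(* Let $\nu,\gamma,\delta,\mu>0$ and $h>0$ satisfy $\nu\ge\frac{\mu c_p^2h^2}{2}$ and $\mu\ge2(\gamma+\nu)$. Then the backward Euler scheme with given initial datum $Y^0=y_{0h}\in S_h$ and step size $k>0$ admits a unique solution $\{Y^n\}_{n\ge1}\subset S_h$.
   Context: Notation: $(\cdot,\cdot)$ and $\|\cdot\|$ are the inner product and norm of $L^2(0,1)$; $\|v\|_1^2=\|v\|^2+\|v_x\|^2$; $H^1_{\{0\}}(0,1)=\{v\in H^1(0,1): v(0)=0\}$. Interpolation operator: $I_h:H^1(0,1)\to L^2(0,1)$ is linear and satisfies $\|\phi-I_h(\phi)\|\le c_ph\|\phi\|_1$ for all $\phi\in H^1(0,1)$, with $c_p$ independent of $\phi$ and $h$. Finite element space: $0=x_0<x_1<\dots<x_N=1$ is a partition of $(0,1)$ into $I_j=(x_{j-1},x_j)$ of length $h_j$, $h=\max_jh_j$, and $S_h\subset H^1_{\{0\}}(0,1)$ is the space of continuous functions $v_h$ on $[0,1]$ that are polynomials of degree $\le1$ on each $I_j$, with $v_h(0)=0$. Backward Euler scheme: $k=T/M$, $t_n=nk$, $\bar\partial_t\phi^n=(\phi^n-\phi^{n-1})/k$. Find $Y^n\in S_h$, $n\ge1$, with $$(\bar\partial_tY^n,\chi)+\nu(Y^n_x,\chi_x)-\gamma(Y^n,\chi)+\delta((Y^n)^3,\chi)=-\mu(I_h(Y^n),\chi)\quad\forall\chi\in S_h,\qquad Y^0=y_{0h}.$$ *)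

theory Defs
  imports "HOL-Analysis.Analysis" "HOL-Computational_Algebra.Polynomial"
begin

(* Elements of L^2(0,1) and H^1(0,1) are represented by functions real => real; only the
   values on (0,1) matter, and equality in these spaces is equality almost everywhere. *)

abbreviation leb01 :: "real measure" where
  "leb01 \<equiv> lebesgue_on {0<..<1}"

definition L2 :: "(real \<Rightarrow> real) set" where
  "L2 = {f. f \<in> borel_measurable leb01 \<and> integrable leb01 (\<lambda>x. (f x)\<^sup>2)}"

definition L2_inner :: "(real \<Rightarrow> real) \<Rightarrow> (real \<Rightarrow> real) \<Rightarrow> real" where
  "L2_inner f g = (LINT x|leb01. f x * g x)"

definition L2_norm :: "(real \<Rightarrow> real) \<Rightarrow> real" where
  "L2_norm f = sqrt (L2_inner f f)"

(* Weak derivative on (0,1), tested against C^1 functions with compact support in (0,1). *)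
definition has_weak_deriv :: "(real \<Rightarrow> real) \<Rightarrow> (real \<Rightarrow> real) \<Rightarrow> bool" where
  "has_weak_deriv v g \<longleftrightarrow>
     (\<forall>\<phi> \<phi>'. (\<forall>x. (\<phi> has_real_derivative \<phi>' x) (at x)) \<and> continuous_on UNIV \<phi>' \<and>
             closure {x. \<phi> x \<noteq> 0} \<subseteq> {0<..<1} \<longrightarrow>
             (LINT x|leb01. v x * \<phi>' x) = - (LINT x|leb01. g x * \<phi> x))"

definition H1 :: "(real \<Rightarrow> real) set" where
  "H1 = {v \<in> L2. \<exists>g\<in>L2. has_weak_deriv v g}"

(* For v in H1 the choice is unique up to a null set. *)
definition weak_deriv :: "(real \<Rightarrow> real) \<Rightarrow> real \<Rightarrow> real" where
  "weak_deriv v = (SOME g. g \<in> L2 \<and> has_weak_deriv v g)"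

definition H1_norm :: "(real \<Rightarrow> real) \<Rightarrow> real" where
  "H1_norm v = sqrt ((L2_norm v)\<^sup>2 + (L2_norm (weak_deriv v))\<^sup>2)"

(* Linearity is an identity in L^2, hence almost everywhere.  Together with the error bound
   it makes I respect almost-everywhere equality of its arguments. *)
definition interpolation_operator ::
    "real \<Rightarrow> real \<Rightarrow> ((real \<Rightarrow> real) \<Rightarrow> real \<Rightarrow> real) \<Rightarrow> bool" where
  "interpolation_operator c\<^sub>p h I \<longleftrightarrow>
     (\<forall>\<phi>\<in>H1. I \<phi> \<in> L2) \<and>
     (\<forall>\<phi>\<in>H1. \<forall>\<psi>\<in>H1. \<forall>a b.
        AE x in leb01. I (\<lambda>t. a * \<phi> t + b * \<psi> t) x = a * I \<phi> x + b * I \<psi> x) \<and>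
     (\<forall>\<phi>\<in>H1. L2_norm (\<lambda>x. \<phi> x - I \<phi> x) \<le> c\<^sub>p * h * H1_norm \<phi>)"

definition partition01 :: "nat \<Rightarrow> (nat \<Rightarrow> real) \<Rightarrow> bool" where
  "partition01 N x \<longleftrightarrow> x 0 = 0 \<and> x N = 1 \<and> (\<forall>j\<in>{1..N}. x (j - 1) < x j)"

definition mesh_size :: "nat \<Rightarrow> (nat \<Rightarrow> real) \<Rightarrow> real" where
  "mesh_size N x = Max ((\<lambda>j. x j - x (j - 1)) ` {1..N})"

(* A function on [0,1] is represented by its extension by zero to the real line, so that
   equality of functions on [0,1] is equality of their representatives. *)
definition fe_space :: "nat \<Rightarrow> (nat \<Rightarrow> real) \<Rightarrow> (real \<Rightarrow> real) set" where
  "fe_space N x =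
     {v. continuous_on {0..1} v \<and> v 0 = 0 \<and>
         (\<forall>j\<in>{1..N}. \<exists>p. degree p \<le> 1 \<and> (\<forall>t\<in>{x (j - 1)<..<x j}. v t = poly p t)) \<and>
         (\<forall>t. t \<notin> {0..1} \<longrightarrow> v t = 0)}"

definition backward_Euler_solution ::
    "(real \<Rightarrow> real) set \<Rightarrow> ((real \<Rightarrow> real) \<Rightarrow> real \<Rightarrow> real) \<Rightarrow>
     real \<Rightarrow> real \<Rightarrow> real \<Rightarrow> real \<Rightarrow> real \<Rightarrow> (real \<Rightarrow> real) \<Rightarrow> (nat \<Rightarrow> real \<Rightarrow> real) \<Rightarrow> bool" where
  "backward_Euler_solution S I \<nu> \<gamma> \<delta> \<mu> k y\<^sub>0 Y \<longleftrightarrow>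
     Y 0 = y\<^sub>0 \<and>
     (\<forall>n\<ge>1. Y n \<in> S \<and>
        (\<forall>w\<in>S. L2_inner (\<lambda>t. (Y n t - Y (n - 1) t) / k) w
               + \<nu> * L2_inner (weak_deriv (Y n)) (weak_deriv w)
               - \<gamma> * L2_inner (Y n) w
               + \<delta> * L2_inner (\<lambda>t. (Y n t) ^ 3) w
               = - \<mu> * L2_inner (I (Y n)) w))"

end

(* With the ramps r_j of slope 1 on the j-th cell as basis, one Euler step is a system G(a) = 0 in the
   slopes a.  Since (I_h d, d) = |d|^2 - (d - I_h d, d), Young's inequality and the interpolation
   error bound give (G(a) - G(b), a - b) >= |d|^2 / k for d = sum (a_j - b_j) r_j: the two
   parameter conditions absorb the error terms and -gamma, and the cubic term is monotone.  As |d|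
   bounds the slopes of d, G is strongly monotone, hence has exactly one zero. *)
theory Submission
  imports Defs
begin

section \<open>Strongly monotone maps\<close>

text \<open>Two obstacles shape the proof. Moreover \<open>I\<close> is linear only almost
  everywhere and \<open>weak_deriv\<close> is a Hilbert choice, so both can be handled only up to
  null sets. To compute the diffusion term, the weak derivative of a piecewise linear function has
  to be identified with its step function, which takes the uniqueness of weak derivatives. Where the
  two parameter conditions come from: \<mu> (I d, d) = \<mu>/2 (|d|^2 - |d - I d|^2 + |I d|^2), and
  \<mu>/2 |d - I d|^2 is at most \<nu> |d|^2 + \<nu> |d_x|^2 by the first condition. Diffusion pays
  for \<nu> |d_x|^2, and the second condition, \<mu>/2 - \<gamma> >= \<nu>, pays for \<nu> |d|^2.
  The term |d|^2 / k of the time difference is left over, whatever the size of k.\<close>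

lemma strongly_monotone_real_zero:
  fixes g :: "real \<Rightarrow> real"
  assumes cont: "continuous_on UNIV g" and "c > 0"
    and mono: "\<And>s t. c * (s - t)\<^sup>2 \<le> (g s - g t) * (s - t)"
  shows "\<exists>t. g t = 0"
proof -
  \<comment> \<open>Strong monotonicity makes g grow at rate at least c, so after the distance |g 0|
    / c the value g 0 has been compensated on either side.\<close>
  define b where "b = \<bar>g 0\<bar> / c"
  have b: "b \<ge> 0" "c * b = \<bar>g 0\<bar>"
    using \<open>c > 0\<close> by (auto simp: b_def)
  have up: "g b \<ge> 0"
  proof (cases "b = 0")
    case True
    then show ?thesis using b by auto
  next
    case False
    then have "b > 0" using b by simp
    have "c * b * b \<le> (g b - g 0) * b"
      using mono[of b 0] by (simp add: power2_eq_square)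
    then have "c * b \<le> g b - g 0"
      using \<open>b > 0\<close> mult_le_cancel_right_pos by blast
    then show ?thesis using b by linarith
  qed
  have low: "g (-b) \<le> 0"
  proof (cases "b = 0")
    case True
    then show ?thesis using b by auto
  next
    case False
    then have "b > 0" using b by simp
    have "c * b * b \<le> (g 0 - g (-b)) * b"
      using mono[of 0 "-b"] by (simp add: power2_eq_square)
    then have "c * b \<le> g 0 - g (-b)"
      using \<open>b > 0\<close> mult_le_cancel_right_pos by blast
    then show ?thesis using b by linarith
  qed
  show ?thesis
    using IVT'[of g "-b" 0 b] low up b continuous_on_subset[OF cont] by auto
qed

text \<open>Solve the first \<open>n\<close> equations as a function of the last unknown; strong monotonicity makes
  this solution continuous in the last unknown and the remaining scalar equation strongly
  monotone.\<close>

lemma strongly_monotone_zero: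
  fixes G :: "(nat \<Rightarrow> real) \<Rightarrow> nat \<Rightarrow> real"
  assumes "\<And>i. i < n \<Longrightarrow> continuous_on UNIV (\<lambda>a. G a i)" and "c > 0"
    and "\<And>a b. (\<And>i. i \<ge> n \<Longrightarrow> a i = b i) \<Longrightarrow>
           c * (\<Sum>i<n. (a i - b i)\<^sup>2) \<le> (\<Sum>i<n. (G a i - G b i) * (a i - b i))"
  shows "\<exists>a. (\<forall>i\<ge>n. a i = z i) \<and> (\<forall>i<n. G a i = 0)"
  using assms
proof (induction n arbitrary: z)
  case 0
  show ?case by auto
next
  case (Suc n)
  note mono = Suc.prems(3)
  have "\<exists>a. (\<forall>i\<ge>n. a i = (z(n := t)) i) \<and> (\<forall>i<n. G a i = 0)" for t
  proof (rule Suc.IH)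
    fix a b :: "nat \<Rightarrow> real"
    assume eq: "\<And>i. i \<ge> n \<Longrightarrow> a i = b i"
    \<comment> \<open>Agreement at index n kills the last summand of both sums for
      \<open>Suc n\<close>, so the hypothesis restricts to n with the same c.\<close>
    show "c * (\<Sum>i<n. (a i - b i)\<^sup>2) \<le> (\<Sum>i<n. (G a i - G b i) * (a i - b i))"
      using mono[of a b] eq by simp
  qed (use Suc.prems in auto)
  then obtain A where A: "\<And>t i. i \<ge> n \<Longrightarrow> A t i = (z(n := t)) i"
      "\<And>t i. i < n \<Longrightarrow> G (A t) i = 0"
    by metis
  have cont_A: "continuous_on UNIV (\<lambda>t. A t i)" for i
  proof (cases "i < n")
    case False
    then show ?thesis
      using A(1)[of i] by (cases "i = n") auto
  next
    case True
    show ?thesis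
    proof (intro continuous_at_imp_continuous_on ballI)
      fix s :: real
      \<comment> \<open>\<open>B t\<close> has the last unknown of \<open>A t\<close> but the first
        n coordinates of \<open>A s\<close>. It agrees with \<open>A t\<close> from n on, so
        monotonicity bounds the distance of the two by the residual \<open>R t\<close> of
        \<open>B t\<close>, which tends to \<open>R s\<close> = 0.\<close>
      define B where "B = (\<lambda>t. (A s)(n := t))"
      define R where "R = (\<lambda>t. \<Sum>i<n. \<bar>G (B t) i\<bar>)"
      have "continuous_on UNIV B"
        unfolding B_def
      proof (rule continuous_on_coordinatewise_then_product)
        show "continuous_on UNIV (\<lambda>t. ((A s)(n := t)) i)" for i
          by (cases "i = n") auto
      qed
      then have "continuous_on UNIV (\<lambda>t. G (B t) i)" if "i < n" for i
        using continuous_on_compose2[OF Suc.prems(1)[of i], of UNIV B] that by simp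
      then have "continuous_on UNIV R"
        unfolding R_def by (intro continuous_intros) auto
      then have R_tendsto: "(R \<longlongrightarrow> R s) (at s)"
        by (simp add: continuous_on_eq_continuous_at isCont_def)
      have "B s = A s"
        using A(1)[of n s] by (auto simp: B_def)
      then have "R s = 0"
        using A(2) by (simp add: R_def)
      with R_tendsto have R: "((\<lambda>t. R t / c) \<longlongrightarrow> 0) (at s)"
        using tendsto_divide[of R "R s" "at s" "\<lambda>_. c" c] \<open>c > 0\<close> by simp
      have bound: "\<bar>A t i - A s i\<bar> \<le> R t / c" for t
      proof -
        \<comment> \<open>With the maximum norm m of the difference, monotonicity yields c m^2 <= R
          m, and one factor m cancels.\<close>
        define m where "m = Max ((\<lambda>i. \<bar>A t i - A s i\<bar>) ` {..<n})"
        have le_m: "\<bar>A t j - A s j\<bar> \<le> m" if "j < n" for j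
          using that by (auto simp: m_def intro!: Max_ge)
        have "m \<in> (\<lambda>i. \<bar>A t i - A s i\<bar>) ` {..<n}"
          unfolding m_def using True by (intro Max_in) auto
        then obtain j where j: "j < n" "m = \<bar>A t j - A s j\<bar>"
          by auto
        have tail: "A t i = B t i" if "i \<ge> n" for i
          using that A(1)[of i] by (auto simp: B_def)
        have "c * (A t j - A s j)\<^sup>2 \<le> c * (\<Sum>i<n. (A t i - B t i)\<^sup>2)"
        proof -
          have "(A t j - A s j)\<^sup>2 = (\<Sum>i\<in>{j}. (A t i - B t i)\<^sup>2)"
            using j by (simp add: B_def)
          also have "\<dots> \<le> (\<Sum>i<n. (A t i - B t i)\<^sup>2)"
            using j by (intro sum_mono2) auto
          finally show ?thesis using \<open>c > 0\<close> by simp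
        qed
        also have "\<dots> \<le> (\<Sum>i<n. (G (A t) i - G (B t) i) * (A t i - B t i))"
          using mono[of "A t" "B t"] tail by simp
        also have "\<dots> \<le> (\<Sum>i<n. \<bar>G (B t) i\<bar> * m)"
        proof (intro sum_mono)
          fix i assume "i \<in> {..<n}"
          then have "i < n" by simp
          have "(G (A t) i - G (B t) i) * (A t i - B t i) \<le> \<bar>G (B t) i\<bar> * \<bar>A t i - A s i\<bar>"
            using A(2)[OF \<open>i < n\<close>, of t] \<open>i < n\<close>
            by (simp add: B_def abs_mult[symmetric] abs_le_iff)
          also have "\<dots> \<le> \<bar>G (B t) i\<bar> * m"
            using le_m[OF \<open>i < n\<close>] by (intro mult_left_mono) auto
          finally show "(G (A t) i - G (B t) i) * (A t i - B t i) \<le> \<bar>G (B t) i\<bar> * m" .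
        qed
        also have "\<dots> = R t * m"
          by (simp add: R_def sum_distrib_right)
        finally have "c * m * m \<le> R t * m"
          using j by (simp add: power2_eq_square mult.assoc)
        moreover have "m \<ge> 0" "R t \<ge> 0"
          using j by (auto simp: R_def intro: sum_nonneg)
        ultimately have "c * m \<le> R t"
          using \<open>c > 0\<close> by (cases "m = 0") auto
        then have "m \<le> R t / c"
          using \<open>c > 0\<close> by (simp add: field_simps)
        then show ?thesis
          using le_m[OF True] by linarith
      qed
      have "((\<lambda>t. A t i - A s i) \<longlongrightarrow> 0) (at s)"
        by (rule Lim_null_comparison[OF _ R]) (use bound in auto)
      then show "isCont (\<lambda>t. A t i) s"
        by (simp add: isCont_def LIM_zero_iff)
    qed
  qed
  have "\<exists>t. G (A t) n = 0"
  proof (rule strongly_monotone_real_zero)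
    show "continuous_on UNIV (\<lambda>t. G (A t) n)"
      using continuous_on_compose2[OF Suc.prems(1)[of n], of UNIV A]
        continuous_on_coordinatewise_then_product[of UNIV A] cont_A by simp
    show "c * (s - t)\<^sup>2 \<le> (G (A s) n - G (A t) n) * (s - t)" for s t
    proof -
      have "c * (s - t)\<^sup>2 \<le> c * (\<Sum>i<Suc n. (A s i - A t i)\<^sup>2)"
        using A(1)[of n] \<open>c > 0\<close> by (simp add: sum_nonneg)
      also have "\<dots> \<le> (\<Sum>i<Suc n. (G (A s) i - G (A t) i) * (A s i - A t i))"
        by (rule mono) (use A(1) in auto)
      \<comment> \<open>For i < n both values of G vanish by the choice of A, and the coordinates at
        n are s and t.\<close>
      also have "\<dots> = (G (A s) n - G (A t) n) * (s - t)"
        using A by simp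
      finally show ?thesis .
    qed
  qed (fact \<open>c > 0\<close>)
  then obtain t where "G (A t) n = 0" by blast
  then show ?case
    using A by (intro exI[of _ "A t"]) (auto simp: less_Suc_eq)
qed

section \<open>Uniqueness of weak derivatives\<close>

text \<open>The squared positive part vanishes on a half line and is still C^1. As
  \<open>has_weak_deriv\<close> tests with C^1 functions, cutoffs can be built from it without
  smooth bump functions.\<close>

lemma has_real_derivative_pos_part_square:
  "((\<lambda>y::real. (max 0 y)\<^sup>2) has_real_derivative 2 * max 0 y) (at y)"
proof -
  consider "y < 0" | "y > 0" | "y = 0" by linarith
  then show ?thesis
  proof cases
    case 1
    show ?thesis
      by (rule has_field_derivative_transform_within_open[of "\<lambda>_. 0" _ _ "{..<0}"]) (use 1 in auto)
  next
    case 2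
    show ?thesis
      by (rule has_field_derivative_transform_within_open[of "\<lambda>y. y\<^sup>2" _ _ "{0<..}"])
        (use 2 in \<open>auto intro!: derivative_eq_intros\<close>)
  next
    case 3
    have "((\<lambda>h::real. (max 0 h)\<^sup>2 / h) \<longlongrightarrow> 0) (at 0)"
    proof (rule Lim_null_comparison)
      show "\<forall>\<^sub>F h in at 0. norm ((max 0 h)\<^sup>2 / h) \<le> \<bar>h::real\<bar>"
        by (intro always_eventually allI) (auto simp: max_def power2_eq_square)
      show "((\<lambda>h::real. \<bar>h\<bar>) \<longlongrightarrow> 0) (at 0)"
        by (auto intro!: tendsto_eq_intros)
    qed
    then show ?thesis
      using 3 by (simp add: DERIV_def)
  qed
qed

lemma DERIV_pos_part_square:
  fixes g :: "real \<Rightarrow> real"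
  assumes "(g has_real_derivative d) (at t)"
  shows "((\<lambda>t. (max 0 (g t))\<^sup>2) has_real_derivative 2 * max 0 (g t) * d) (at t)"
  by (rule DERIV_chain2[where f = "\<lambda>y. (max 0 y)\<^sup>2", OF has_real_derivative_pos_part_square assms])

text \<open>These are admissible test functions converging boundedly to an indicator, so that
  dominated convergence turns testing against them into integration over an interval.\<close>

lemma C1_approx_indicator_interval:
  fixes a b :: real
  obtains \<phi> \<phi>' :: "nat \<Rightarrow> real \<Rightarrow> real"
  where "\<And>n t. (\<phi> n has_real_derivative \<phi>' n t) (at t)"
    and "\<And>n. continuous_on UNIV (\<phi>' n)"
    and "\<And>n. closure {t. \<phi> n t \<noteq> 0} \<subseteq> {a<..<b}"
    and "\<And>n t. \<bar>\<phi> n t\<bar> \<le> 1"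
    and "\<And>t. (\<lambda>n. \<phi> n t) \<longlonglongrightarrow> indicator {a<..<b} t"
proof -
  \<comment> \<open>Shrinking the interval by a positive \<open>e n\<close> at both ends keeps the
    closed support inside the open interval.\<close>
  define e where "e = (\<lambda>n. 1 / real (Suc n))"
  define p where "p = (\<lambda>n t. (max 0 (t - a - e n))\<^sup>2)"
  define q where "q = (\<lambda>n t. (max 0 (b - e n - t))\<^sup>2)"
  define p' where "p' = (\<lambda>n t. 2 * max 0 (t - a - e n))"
  define q' where "q' = (\<lambda>n t. - 2 * max 0 (b - e n - t))"
  define \<psi> where "\<psi> = (\<lambda>n t. real n * (p n t * q n t))"
  define \<psi>' where "\<psi>' = (\<lambda>n t. real n * (p' n t * q n t + p n t * q' n t))"
  \<comment> \<open>The map s / (1 + s) sends [0, \<infinity>) into [0, 1). It keeps zeros at zero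
    and tends to 1 where \<psi> grows without bound, which the factor n achieves at every point of
    the interval.\<close>
  define \<phi> where "\<phi> = (\<lambda>n t. \<psi> n t / (1 + \<psi> n t))"
  define \<phi>' where "\<phi>' = (\<lambda>n t. \<psi>' n t / (1 + \<psi> n t)\<^sup>2)"
  have e: "e n > 0" for n
    by (simp add: e_def)
  have nonneg: "\<psi> n t \<ge> 0" for n t
    by (simp add: \<psi>_def p_def q_def)
  have p: "(p n has_real_derivative p' n t) (at t)" for n t
  proof -
    have "((\<lambda>t. t - a - e n) has_real_derivative 1) (at t)"
      by (auto intro!: derivative_eq_intros)
    from DERIV_pos_part_square[OF this] show ?thesis
      by (simp add: p_def p'_def)
  qed
  have q: "(q n has_real_derivative q' n t) (at t)" for n t
  proof -
    have "((\<lambda>t. b - e n - t) has_real_derivative - 1) (at t)"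
      by (auto intro!: derivative_eq_intros)
    from DERIV_pos_part_square[OF this] show ?thesis
      by (simp add: q_def q'_def)
  qed
  have \<psi>: "(\<psi> n has_real_derivative \<psi>' n t) (at t)" for n t
    unfolding \<psi>_def \<psi>'_def
    by (rule DERIV_cong[OF DERIV_cmult[OF DERIV_mult[OF p q]]]) (simp add: algebra_simps)
  have 1: "(\<phi> n has_real_derivative \<phi>' n t) (at t)" for n t
  proof -
    have "1 + \<psi> n t \<noteq> 0"
      using nonneg[of n t] by linarith
    then show ?thesis
      unfolding \<phi>_def \<phi>'_def
      by (intro DERIV_cong[OF DERIV_divide[OF \<psi> DERIV_add[OF DERIV_const \<psi>]]])
        (simp_all add: power2_eq_square algebra_simps)
  qed
  have 2: "continuous_on UNIV (\<phi>' n)" for n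
  proof -
    have "1 + \<psi> n t \<noteq> 0" for t
      using nonneg[of n t] by linarith
    moreover have "continuous_on UNIV (\<psi> n)"
      using \<psi> by (meson DERIV_isCont continuous_at_imp_continuous_on)
    moreover have "continuous_on UNIV (\<psi>' n)"
      unfolding \<psi>'_def p_def p'_def q_def q'_def by (intro continuous_intros)
    ultimately show ?thesis
      unfolding \<phi>'_def by (auto intro!: continuous_intros)
  qed
  have 3: "closure {t. \<phi> n t \<noteq> 0} \<subseteq> {a<..<b}" for n
  proof -
    have "{t. \<phi> n t \<noteq> 0} \<subseteq> {a + e n..b - e n}"
      by (auto simp: \<phi>_def \<psi>_def p_def q_def max_def split: if_splits)
    then have "closure {t. \<phi> n t \<noteq> 0} \<subseteq> {a + e n..b - e n}"
      by (rule closure_minimal) simp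
    also have "\<dots> \<subseteq> {a<..<b}"
      using e[of n] by auto
    finally show ?thesis .
  qed
  have 4: "\<bar>\<phi> n t\<bar> \<le> 1" for n t
    using nonneg[of n t] by (simp add: \<phi>_def)
  have 5: "(\<lambda>n. \<phi> n t) \<longlonglongrightarrow> indicator {a<..<b} t" for t
  proof (cases "t \<in> {a<..<b}")
    case True
    have "e \<longlonglongrightarrow> 0"
      unfolding e_def by (rule LIMSEQ_Suc, rule lim_1_over_n)
    then have "(\<lambda>n. p n t * q n t) \<longlonglongrightarrow> (max 0 (t - a - 0))\<^sup>2 * (max 0 (b - 0 - t))\<^sup>2"
      unfolding p_def q_def by (intro tendsto_intros)
    moreover have "(max 0 (t - a - 0))\<^sup>2 * (max 0 (b - 0 - t))\<^sup>2 > 0"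
      using True by auto
    ultimately have "filterlim (\<lambda>n. p n t * q n t * real n) at_top sequentially"
      using filterlim_tendsto_pos_mult_at_top filterlim_real_sequentially by blast
    then have "filterlim (\<lambda>n. 1 + \<psi> n t) at_top sequentially"
      unfolding \<psi>_def
      by (intro filterlim_tendsto_add_at_top[OF tendsto_const]) (simp add: mult.commute)
    then have "(\<lambda>n. 1 - inverse (1 + \<psi> n t)) \<longlonglongrightarrow> 1 - 0"
      by (intro tendsto_diff tendsto_const tendsto_inverse_0_at_top)
    moreover have "1 - inverse (1 + \<psi> n t) = \<phi> n t" for n
      using nonneg[of n t] by (simp add: \<phi>_def field_simps)
    ultimately show ?thesis
      using True by simp
  next
    case False
    then have "\<phi> n t = 0" for n
      using 3[of n] closure_subset[of "{t. \<phi> n t \<noteq> 0}"] by blast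
    then show ?thesis
      using False by simp
  qed
  show ?thesis
    using 1 2 3 4 5 by (rule that)
qed

text \<open>Open intervals are an intersection-stable generator of the Borel sets, so vanishing
  integrals spread to Borel sets by the pi-lambda theorem, then to Lebesgue sets by
  completion.\<close>

lemma AE_zero_if_interval_integrals_zero:
  fixes f :: "real \<Rightarrow> real"
  assumes f: "integrable lebesgue f"
    and zero: "\<And>a b. (LINT t:{a<..<b}|lebesgue. f t) = 0"
  shows "AE t in lebesgue. f t = 0"
proof -
  have int: "set_integrable lebesgue A f" if "A \<in> sets lebesgue" for A
    unfolding set_integrable_def by (rule integrable_mult_indicator[OF that f])
  have lb: "A \<in> sets borel \<Longrightarrow> A \<in> sets lebesgue" for A :: "real set"
    by simp
  let ?gen = "range (\<lambda>(a, b). {a<..<b :: real})"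
  have gen: "sets borel = sigma_sets UNIV ?gen"
  proof -
    have "(\<lambda>(a, b). box a b) = (\<lambda>(a, b). {a<..<b :: real})"
      by auto
    then show ?thesis
      by (simp only: borel_eq_box) (rule sets_measure_of, simp)
  qed
  have stable: "Int_stable ?gen"
  proof (rule Int_stableI_image)
    fix i j :: "real \<times> real"
    show "\<exists>k\<in>UNIV. (case i of (a, b) \<Rightarrow> {a<..<b}) \<inter> (case j of (a, b) \<Rightarrow> {a<..<b}) =
        (case k of (a, b) \<Rightarrow> {a<..<b})"
      by (intro bexI[of _ "(max (fst i) (fst j), min (snd i) (snd j))"])
        (auto simp: case_prod_beta)
  qed
  \<comment> \<open>Needed for complements in the pi-lambda induction: the whole line is not a
    bounded interval but a limit of them.\<close>
  have total: "(LINT t|lebesgue. f t) = 0"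
  proof -
    have "(\<lambda>n. LINT t|lebesgue. indicator {- real n<..<real n} t *\<^sub>R f t) \<longlonglongrightarrow> (LINT t|lebesgue. f t)"
    proof (rule integral_dominated_convergence[where w = "\<lambda>t. \<bar>f t\<bar>"])
      show "AE t in lebesgue. (\<lambda>n. indicator {- real n<..<real n} t *\<^sub>R f t) \<longlonglongrightarrow> f t"
      proof (intro AE_I2 tendsto_eventually)
        fix t :: real
        obtain m where "\<bar>t\<bar> < real m"
          using reals_Archimedean2 by blast
        then show "\<forall>\<^sub>F n in sequentially. indicator {- real n<..<real n} t *\<^sub>R f t = f t"
          by (intro eventually_sequentiallyI[of m]) (auto simp: indicator_def)
      qed
      show "(\<lambda>t. indicator {- real n<..<real n} t *\<^sub>R f t) \<in> borel_measurable lebesgue" for n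
        using f by (intro borel_measurable_scaleR borel_measurable_indicator) auto
    qed (use f in \<open>auto simp: indicator_def\<close>)
    moreover have "(\<lambda>n. LINT t|lebesgue. indicator {- real n<..<real n} t *\<^sub>R f t) = (\<lambda>n. 0)"
      using zero by (simp add: set_lebesgue_integral_def)
    ultimately show ?thesis
      using LIMSEQ_unique tendsto_const by metis
  qed
  have borel: "(LINT t:A|lebesgue. f t) = 0" if "A \<in> sets borel" for A
  proof -
    have "A \<in> sigma_sets UNIV ?gen"
      using that gen by simp
    with stable subset_UNIV[of ?gen, folded Pow_UNIV] show ?thesis
    proof (induction rule: sigma_sets_induct_disjoint)
      case (basic A)
      then show ?case using zero by auto
    next
      case empty
      show ?case by (simp add: set_lebesgue_integral_def)
    next
      case (compl A)
      then have A: "A \<in> sets lebesgue"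
        using lb gen by blast
      have "(LINT t:A \<union> (UNIV - A)|lebesgue. f t)
          = (LINT t:A|lebesgue. f t) + (LINT t:UNIV - A|lebesgue. f t)"
        using A by (intro set_integral_Un int) auto
      then show ?case
        using compl.IH total by (simp add: set_lebesgue_integral_def)
    next
      case (union A)
      then have A: "A i \<in> sets lebesgue" for i
        using lb gen by blast
      have "(LINT t:(\<Union>i. A i)|lebesgue. f t) = (\<Sum>i. (LINT t:(A i)|lebesgue. f t))"
        using A union.hyps by (intro lebesgue_integral_countable_add int) (auto simp: disjoint_family_on_def)
      then show ?case
        using union.IH by simp
    qed
  qed
  \<comment> \<open>A Lebesgue set is a Borel set S up to a subset M of a Borel null set, and M does
    not change the integral.\<close>
  have all: "(LINT t:A|lebesgue. f t) = 0" if "A \<in> sets lebesgue" for A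
  proof -
    obtain S M M' where A: "A = S \<union> M" "M \<subseteq> M'" "M' \<in> null_sets lborel" "S \<in> sets lborel"
      using sets_completionE[OF \<open>A \<in> sets lebesgue\<close>] by blast
    then have "AE t in lebesgue. t \<notin> M'"
      by (intro AE_not_in) (simp add: null_sets_completionI)
    then have "AE t in lebesgue. indicator A t *\<^sub>R f t = indicator S t *\<^sub>R f t"
      by eventually_elim (use A in \<open>auto simp: indicator_def\<close>)
    then have "(LINT t:A|lebesgue. f t) = (LINT t:S|lebesgue. f t)"
      unfolding set_lebesgue_integral_def
    proof (intro integral_cong_AE)
      show "AE t in lebesgue. indicator A t *\<^sub>R f t = indicator S t *\<^sub>R f t" by fact
      have "(\<lambda>t. indicator B t *\<^sub>R f t) \<in> borel_measurable lebesgue" if "B \<in> sets lebesgue" for B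
        using that f by (intro borel_measurable_scaleR borel_measurable_indicator) auto
      then show "(\<lambda>t. indicator A t *\<^sub>R f t) \<in> borel_measurable lebesgue"
        "(\<lambda>t. indicator S t *\<^sub>R f t) \<in> borel_measurable lebesgue"
        using A(4) \<open>A \<in> sets lebesgue\<close> by auto
    qed
    then show ?thesis
      using borel A by simp
  qed
  interpret sigma_finite_measure "lebesgue :: real measure"
  proof
    obtain A :: "real set set" where A: "countable A" "A \<subseteq> sets lborel" "\<Union>A = space lborel"
        "\<forall>a\<in>A. emeasure lborel a \<noteq> \<infinity>"
      using lborel.sigma_finite_countable by blast
    have "emeasure lebesgue a \<noteq> \<infinity>" "a \<in> sets lebesgue" if "a \<in> A" for a
      using A that by (auto simp: emeasure_completion subset_iff)
    then show "\<exists>A. countable A \<and> A \<subseteq> sets lebesgue \<and> \<Union>A = space lebesgue \<and>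
        (\<forall>a\<in>A. emeasure (lebesgue :: real measure) a \<noteq> \<infinity>)"
      using A by (intro exI[of _ A]) auto
  qed
  show ?thesis
    using density_zero[OF f] all by blast
qed

text \<open>The difference of two weak derivatives is orthogonal to every test function, hence by
  approximation integrates to zero over every open subinterval of (0,1).\<close>

lemma has_weak_deriv_unique:
  assumes f: "integrable leb01 f" "has_weak_deriv v f" and g: "integrable leb01 g" "has_weak_deriv v g"
  shows "AE t in leb01. f t = g t"
proof -
  define d where "d = (\<lambda>t. f t - g t)"
  have d: "integrable leb01 d"
    using f g by (simp add: d_def)
  have d_Ioo: "(LINT t|leb01. indicator {a<..<b} t * d t) = 0" if "{a<..<b} \<subseteq> {0<..<1}" for a b
  proof -
    obtain \<phi> \<phi>' :: "nat \<Rightarrow> real \<Rightarrow> real"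
      where 1: "\<And>n t. (\<phi> n has_real_derivative \<phi>' n t) (at t)"
        and 2: "\<And>n. continuous_on UNIV (\<phi>' n)"
        and 3: "\<And>n. closure {t. \<phi> n t \<noteq> 0} \<subseteq> {a<..<b}"
        and 4: "\<And>n t. \<bar>\<phi> n t\<bar> \<le> 1"
        and 5: "\<And>t. (\<lambda>n. \<phi> n t) \<longlonglongrightarrow> indicator {a<..<b} t"
      using C1_approx_indicator_interval by blast
    have [measurable]: "\<phi> n \<in> borel_measurable leb01" for n
    proof -
      have "continuous_on {0<..<1} (\<phi> n)"
        using 1 by (meson DERIV_isCont continuous_at_imp_continuous_on)
      then show ?thesis
        by (simp add: continuous_imp_measurable_on_sets_lebesgue)
    qed
    note [measurable] = borel_measurable_integrable[OF d]
      borel_measurable_integrable[OF f(1)] borel_measurable_integrable[OF g(1)]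
    have int: "integrable leb01 (\<lambda>t. u t * \<phi> n t)" if "integrable leb01 u" for u n
    proof (rule Bochner_Integration.integrable_bound[OF integrable_norm[OF that]])
      show "(\<lambda>t. u t * \<phi> n t) \<in> borel_measurable leb01"
        using borel_measurable_integrable[OF that] by measurable
      show "AE t in leb01. norm (u t * \<phi> n t) \<le> norm (norm (u t))"
        using 4[of n] by (auto simp: abs_mult mult_left_le)
    qed
    have "(LINT t|leb01. \<phi> n t * d t) = 0" for n
    proof -
      have test: "(\<forall>t. (\<phi> n has_real_derivative \<phi>' n t) (at t)) \<and> continuous_on UNIV (\<phi>' n) \<and>
          closure {t. \<phi> n t \<noteq> 0} \<subseteq> {0<..<1}"
        using 1[of n] 2[of n] 3[of n] that by blast
      have "(LINT t|leb01. f t * \<phi> n t) = (LINT t|leb01. g t * \<phi> n t)"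
        using f(2)[unfolded has_weak_deriv_def, rule_format, OF test]
          g(2)[unfolded has_weak_deriv_def, rule_format, OF test] by simp
      then show ?thesis
        using int[OF f(1)] int[OF g(1)] by (simp add: d_def algebra_simps)
    qed
    moreover have "(\<lambda>n. LINT t|leb01. \<phi> n t * d t)
        \<longlonglongrightarrow> (LINT t|leb01. indicator {a<..<b} t * d t)"
    proof (rule integral_dominated_convergence[where w = "\<lambda>t. \<bar>d t\<bar>"])
      have "{a<..<b} \<in> sets leb01"
        using that by (simp add: sets_restrict_space_iff)
      then show "(\<lambda>t. indicator {a<..<b} t * d t) \<in> borel_measurable leb01"
        by measurable
      show "AE t in leb01. (\<lambda>n. \<phi> n t * d t) \<longlonglongrightarrow> indicator {a<..<b} t * d t"
        using 5 by (intro AE_I2 tendsto_intros)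
      show "AE t in leb01. norm (\<phi> n t * d t) \<le> \<bar>d t\<bar>" for n
        using 4[of n] by (auto simp: abs_mult mult_left_le_one_le)
    qed (use d in auto)
    ultimately show ?thesis
      by (simp add: LIMSEQ_const_iff)
  qed
  \<comment> \<open>Extension by zero reduces arbitrary intervals of the line to their intersections
    with (0,1), for which \<open>d_Ioo\<close> is available.\<close>
  define D where "D = (\<lambda>t. indicator {0<..<1} t *\<^sub>R d t)"
  have "AE t in lebesgue. D t = 0"
  proof (rule AE_zero_if_interval_integrals_zero)
    show "integrable lebesgue D"
      using d by (simp add: D_def integrable_restrict_space)
    fix a b :: real
    define a' b' where "a' = max a 0" and "b' = min b 1"
    have "(LINT t:{a<..<b}|lebesgue. D t)
        = (LINT t|lebesgue. indicator {0<..<1} t *\<^sub>R (indicator {a'<..<b'} t * d t))"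
      unfolding set_lebesgue_integral_def D_def a'_def b'_def
      by (intro Bochner_Integration.integral_cong) (auto simp: indicator_def)
    also have "\<dots> = (LINT t|leb01. indicator {a'<..<b'} t * d t)"
      by (simp add: integral_restrict_space)
    also have "\<dots> = 0"
      by (rule d_Ioo) (auto simp: a'_def b'_def)
    finally show "(LINT t:{a<..<b}|lebesgue. D t) = 0" .
  qed
  then show ?thesis
    by (simp add: AE_restrict_space_iff D_def d_def indicator_def) (auto elim: eventually_mono)
qed

section \<open>The space \<open>L\<^sup>2(0,1)\<close>\<close>

lemma L2_borel_measurable: "f \<in> L2 \<Longrightarrow> f \<in> borel_measurable leb01"
  by (simp add: L2_def)

lemma L2_mult_integrable:
  assumes "f \<in> L2" "g \<in> L2"
  shows "integrable leb01 (\<lambda>t. f t * g t)"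
proof (rule Bochner_Integration.integrable_bound)
  show "integrable leb01 (\<lambda>t. (f t)\<^sup>2 + (g t)\<^sup>2)"
    using assms by (simp add: L2_def)
  show "(\<lambda>t. f t * g t) \<in> borel_measurable leb01"
    using assms by (intro borel_measurable_times L2_borel_measurable)
  show "AE t in leb01. norm (f t * g t) \<le> norm ((f t)\<^sup>2 + (g t)\<^sup>2)"
  proof (intro AE_I2)
    fix t
    have "\<bar>f t * g t\<bar> \<le> \<bar>f t\<bar>\<^sup>2 + \<bar>g t\<bar>\<^sup>2"
      using sum_squares_bound[of "\<bar>f t\<bar>" "\<bar>g t\<bar>"] abs_ge_zero[of "f t * g t"]
      unfolding abs_mult by linarith
    then show "norm (f t * g t) \<le> norm ((f t)\<^sup>2 + (g t)\<^sup>2)"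
      by simp
  qed
qed

lemma L2_cmult: "f \<in> L2 \<Longrightarrow> (\<lambda>t. c * f t) \<in> L2"
  by (auto simp: L2_def power_mult_distrib)

lemma L2_divide: "f \<in> L2 \<Longrightarrow> (\<lambda>t. f t / c) \<in> L2"
  using L2_cmult[of f "1 / c"] by simp

lemma L2_add:
  assumes "f \<in> L2" "g \<in> L2"
  shows "(\<lambda>t. f t + g t) \<in> L2"
  using assms L2_mult_integrable[OF assms] by (auto simp: L2_def power2_sum mult.assoc)

lemma L2_diff:
  assumes "f \<in> L2" "g \<in> L2"
  shows "(\<lambda>t. f t - g t) \<in> L2"
  using L2_add[OF assms(1) L2_cmult[OF assms(2), of "-1"]] by simp

lemma L2_bounded:
  assumes "f \<in> borel_measurable leb01" and "\<And>t. t \<in> {0<..<1} \<Longrightarrow> \<bar>f t\<bar> \<le> C"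
  shows "f \<in> L2"
proof -
  interpret finite_measure leb01
    by (rule finite_measure_lebesgue_on) simp
  have "\<bar>(f t)\<^sup>2\<bar> \<le> C\<^sup>2" if "t \<in> {0<..<1}" for t
    using assms(2)[OF that] by (metis abs_ge_zero abs_power2 power2_abs power_mono)
  then have "integrable leb01 (\<lambda>t. (f t)\<^sup>2)"
    using assms(1) by (intro integrable_const_bound[where B = "C\<^sup>2"]) (auto simp: AE_restrict_space_iff)
  then show ?thesis
    using assms(1) by (simp add: L2_def)
qed

lemma L2_const: "(\<lambda>t. c) \<in> L2"
  by (rule L2_bounded[where C = "\<bar>c\<bar>"]) auto

lemma L2_sum: "(\<And>i. i \<in> A \<Longrightarrow> f i \<in> L2) \<Longrightarrow> (\<lambda>t. \<Sum>i\<in>A. f i t) \<in> L2"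
  by (induction A rule: infinite_finite_induct) (auto intro: L2_add L2_const)

lemma L2_continuous:
  assumes "continuous_on {0..1} f"
  shows "f \<in> L2"
proof -
  have "bounded (f ` {0..1})"
    using compact_continuous_image[OF assms] by (simp add: compact_imp_bounded)
  then obtain C where C: "\<forall>y\<in>f ` {0..1}. norm y \<le> C"
    unfolding bounded_iff by blast
  show ?thesis
  proof (rule L2_bounded)
    have "continuous_on {0<..<1} f"
      by (rule continuous_on_subset[OF assms]) auto
    then show "f \<in> borel_measurable leb01"
      by (simp add: continuous_imp_measurable_on_sets_lebesgue)
  qed (use C in auto)
qed

lemma L2_integrable: "f \<in> L2 \<Longrightarrow> integrable leb01 f"
  using L2_mult_integrable[OF _ L2_const, of f 1] by simp

lemma L2_inner_commute: "L2_inner f g = L2_inner g f"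
  by (simp add: L2_inner_def mult.commute)

lemma L2_inner_add_left:
  "f \<in> L2 \<Longrightarrow> g \<in> L2 \<Longrightarrow> w \<in> L2 \<Longrightarrow> L2_inner (\<lambda>t. f t + g t) w = L2_inner f w + L2_inner g w"
  by (simp add: L2_inner_def distrib_right L2_mult_integrable)

lemma L2_inner_cmult_left: "L2_inner (\<lambda>t. c * f t) w = c * L2_inner f w"
  by (simp add: L2_inner_def mult.assoc)

lemma L2_inner_diff_left:
  "f \<in> L2 \<Longrightarrow> g \<in> L2 \<Longrightarrow> w \<in> L2 \<Longrightarrow> L2_inner (\<lambda>t. f t - g t) w = L2_inner f w - L2_inner g w"
  by (simp add: L2_inner_def left_diff_distrib L2_mult_integrable)

lemma L2_inner_sum_left:
  "(\<And>i. i \<in> A \<Longrightarrow> f i \<in> L2) \<Longrightarrow> w \<in> L2 \<Longrightarrow> L2_inner (\<lambda>t. \<Sum>i\<in>A. f i t) w = (\<Sum>i\<in>A. L2_inner (f i) w)"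
  by (simp add: L2_inner_def sum_distrib_right L2_mult_integrable)

lemma L2_inner_sum_right:
  "(\<And>i. i \<in> A \<Longrightarrow> f i \<in> L2) \<Longrightarrow> w \<in> L2 \<Longrightarrow> L2_inner w (\<lambda>t. \<Sum>i\<in>A. f i t) = (\<Sum>i\<in>A. L2_inner w (f i))"
  by (simp add: L2_inner_sum_left L2_inner_commute[of w])

lemma L2_inner_cong_AE:
  assumes "f \<in> L2" "f' \<in> L2" "g \<in> L2" "g' \<in> L2"
    and "AE t in leb01. f t = f' t" "AE t in leb01. g t = g' t"
  shows "L2_inner f g = L2_inner f' g'"
  unfolding L2_inner_def
proof (rule integral_cong_AE)
  show "AE t in leb01. f t * g t = f' t * g' t"
    using assms(5,6) by eventually_elim simp
qed (use assms L2_borel_measurable in \<open>auto intro!: borel_measurable_times\<close>)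

lemma L2_inner_self_nonneg: "L2_inner f f \<ge> 0"
  by (simp add: L2_inner_def)

lemma L2_norm_power2: "(L2_norm f)\<^sup>2 = L2_inner f f"
  by (simp add: L2_norm_def L2_inner_self_nonneg)

text \<open>About the chosen function only its defining property is known; uniqueness transfers any
  explicit weak derivative to it, up to a null set.\<close>

lemma weak_deriv_AE_eq:
  assumes "g \<in> L2" "has_weak_deriv v g"
  shows "weak_deriv v \<in> L2" "AE t in leb01. weak_deriv v t = g t"
proof -
  have wd: "weak_deriv v \<in> L2 \<and> has_weak_deriv v (weak_deriv v)"
    unfolding weak_deriv_def by (rule someI[of _ g]) (use assms in simp)
  then show "weak_deriv v \<in> L2" by simp
  show "AE t in leb01. weak_deriv v t = g t"
    using wd assms by (intro has_weak_deriv_unique[of _ v] L2_integrable) auto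
qed

text \<open>Integration by parts: the fundamental theorem of calculus for v \<phi> tolerates
  finitely many kinks as long as the product is continuous, and the boundary terms vanish because
  the support of \<phi> avoids 0 and 1.\<close>

lemma has_weak_deriv_piecewise:
  assumes "continuous_on {0..1} v" "g \<in> L2" "finite K"
    and deriv: "\<And>t. t \<in> {0<..<1} - K \<Longrightarrow> (v has_real_derivative g t) (at t)"
  shows "has_weak_deriv v g"
  unfolding has_weak_deriv_def
proof (intro allI impI, elim conjE)
  fix \<phi> \<phi>' :: "real \<Rightarrow> real"
  assume \<phi>: "\<forall>t. (\<phi> has_real_derivative \<phi>' t) (at t)" and \<phi>': "continuous_on UNIV \<phi>'"
    and supp: "closure {t. \<phi> t \<noteq> 0} \<subseteq> {0<..<1}"
  have cont_\<phi>: "continuous_on S \<phi>" for S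
    using \<phi> by (meson DERIV_isCont continuous_at_imp_continuous_on)
  have bdry: "\<phi> 0 = 0" "\<phi> 1 = 0"
    using supp closure_subset[of "{t. \<phi> t \<noteq> 0}"] by force+
  have L2: "v \<in> L2" "\<phi> \<in> L2" "\<phi>' \<in> L2"
    using assms(1) cont_\<phi> continuous_on_subset[OF \<phi>'] by (auto intro: L2_continuous)
  have "((\<lambda>t. v t * \<phi>' t + g t * \<phi> t) has_integral v 1 * \<phi> 1 - v 0 * \<phi> 0) {0..1}"
  proof (rule fundamental_theorem_of_calculus_interior_strong[OF \<open>finite K\<close>])
    show "((\<lambda>t. v t * \<phi> t) has_vector_derivative v t * \<phi>' t + g t * \<phi> t) (at t)"
      if "t \<in> {0<..<1} - K" for t
      using DERIV_mult[OF deriv[OF that], of \<phi> "\<phi>' t"] \<phi>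
      by (simp add: has_real_derivative_iff_has_vector_derivative algebra_simps)
    show "continuous_on {0..1} (\<lambda>t. v t * \<phi> t)"
      using assms(1) cont_\<phi> by (intro continuous_intros)
  qed simp
  \<comment> \<open>So far this is a gauge integral; the integrability of both products of L2
    functions identifies it with the Lebesgue integral in \<open>has_weak_deriv\<close>.\<close>
  then have "((\<lambda>t. v t * \<phi>' t + g t * \<phi> t) has_integral 0) {0<..<1}"
    by (simp add: bdry has_integral_Icc_iff_Ioo)
  moreover have "integrable leb01 (\<lambda>t. v t * \<phi>' t + g t * \<phi> t)"
    using L2 assms(2) by (simp add: L2_mult_integrable)
  ultimately have "(LINT t|leb01. v t * \<phi>' t + g t * \<phi> t) = 0"
    by (simp add: lebesgue_integral_eq_integral integral_unique)
  then show "(LINT t|leb01. v t * \<phi>' t) = - (LINT t|leb01. g t * \<phi> t)"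
    using L2 assms(2) by (simp add: L2_mult_integrable)
qed

section \<open>Piecewise linear functions\<close>

text \<open>This is t clamped to [p,q] and shifted to start at 0. Compared with a hat function, its
  derivative is a single indicator, so the derivative of a \<open>ramp_sum\<close> is the
  \<open>step_sum\<close> with the same coefficients. The zero branch follows the convention of
  \<open>fe_space\<close> outside [0,1].\<close>

definition ramp :: "real \<Rightarrow> real \<Rightarrow> real \<Rightarrow> real" where
  "ramp p q t = (if t \<in> {0..1} then min (max t p) q - p else 0)"

definition ramp_sum :: "nat \<Rightarrow> (nat \<Rightarrow> real) \<Rightarrow> (nat \<Rightarrow> real) \<Rightarrow> real \<Rightarrow> real" where
  "ramp_sum N x a t = (\<Sum>j<N. a j * ramp (x j) (x (Suc j)) t)"

definition step_sum :: "nat \<Rightarrow> (nat \<Rightarrow> real) \<Rightarrow> (nat \<Rightarrow> real) \<Rightarrow> real \<Rightarrow> real" where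
  "step_sum N x a t = (\<Sum>j<N. a j * indicator {x j<..<x (Suc j)} t)"

lemma ramp_sum_diff:
  "ramp_sum N x (\<lambda>i. a i - b i) = (\<lambda>t. ramp_sum N x a t - ramp_sum N x b t)"
  by (simp add: ramp_sum_def fun_eq_iff sum_subtractf left_diff_distrib)

lemma step_sum_diff:
  "step_sum N x (\<lambda>i. a i - b i) = (\<lambda>t. step_sum N x a t - step_sum N x b t)"
  by (simp add: step_sum_def fun_eq_iff sum_subtractf left_diff_distrib)

lemma continuous_on_ramp: "continuous_on {0..1} (ramp p q)"
proof -
  have "continuous_on {0..1} (\<lambda>t. min (max t p) q - p)"
    by (intro continuous_intros)
  then show ?thesis
    by (rule continuous_on_cong[THEN iffD1, rotated -1]) (auto simp: ramp_def)
qed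

lemma ramp_in_L2: "ramp p q \<in> L2"
  by (rule L2_continuous[OF continuous_on_ramp])

lemma indicator_in_L2: "indicator {p<..<q} \<in> L2"
proof (rule L2_bounded)
  show "indicator {p<..<q} \<in> borel_measurable leb01"
    by (intro measurable_restrict_space1 borel_measurable_indicator) simp
  show "\<bar>indicator {p<..<q} t\<bar> \<le> (1::real)" for t
    by (simp add: indicator_def)
qed

lemma continuous_on_ramp_sum: "continuous_on {0..1} (ramp_sum N x a)"
  unfolding ramp_sum_def[abs_def] by (intro continuous_intros continuous_on_ramp)

lemma ramp_sum_in_L2: "ramp_sum N x a \<in> L2"
  by (rule L2_continuous[OF continuous_on_ramp_sum])

lemma ramp_sum_cube_in_L2: "(\<lambda>t. (ramp_sum N x a t) ^ 3) \<in> L2"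
  by (intro L2_continuous continuous_intros continuous_on_ramp_sum)

lemma step_sum_in_L2: "step_sum N x a \<in> L2"
  unfolding step_sum_def[abs_def] by (intro L2_sum L2_cmult indicator_in_L2)

lemma ramp_has_derivative:
  assumes "p < q" "t \<in> {0<..<1} - {p, q}"
  shows "(ramp p q has_real_derivative indicator {p<..<q} t) (at t)"
proof -
  consider "t < p" | "p < t" "t < q" | "q < t"
    using assms by fastforce
  then show ?thesis
  proof cases
    case 1
    show ?thesis
      by (rule has_field_derivative_transform_within_open[of "\<lambda>_. 0" _ _ "{..<p} \<inter> {0<..<1}"])
        (use 1 assms in \<open>auto simp: ramp_def\<close>)
  next
    case 2
    show ?thesis
      by (rule has_field_derivative_transform_within_open[of "\<lambda>t. t - p" _ _ "{p<..<q} \<inter> {0<..<1}"])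
        (use 2 assms in \<open>auto simp: ramp_def intro!: derivative_eq_intros\<close>)
  next
    case 3
    show ?thesis
      by (rule has_field_derivative_transform_within_open[of "\<lambda>_. q - p" _ _ "{q<..} \<inter> {0<..<1}"])
        (use 3 assms in \<open>auto simp: ramp_def\<close>)
  qed
qed

text \<open>Centred at the midpoint, the constant and the linear part of w are orthogonal on the
  cell, so the slope alone bounds the norm from below, whatever \<alpha> is.\<close>

lemma L2_inner_self_ge_slope:
  assumes "p < q" "0 \<le> p" "q \<le> 1" "w \<in> L2"
    and w: "\<And>t. t \<in> {p<..<q} \<Longrightarrow> w t = \<alpha> + d * (t - (p + q) / 2)"
  shows "d\<^sup>2 * ((q - p) ^ 3 / 12) \<le> L2_inner w w"
proof -
  define F where "F = (\<lambda>t. \<alpha>\<^sup>2 * t + \<alpha> * d * (t - (p + q) / 2)\<^sup>2 + d\<^sup>2 * (t - (p + q) / 2) ^ 3 / 3)"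
  have "((\<lambda>t. (\<alpha> + d * (t - (p + q) / 2))\<^sup>2) has_integral F q - F p) {p..q}"
  proof (rule fundamental_theorem_of_calculus)
    fix t
    have "(F has_real_derivative (\<alpha> + d * (t - (p + q) / 2))\<^sup>2) (at t within {p..q})"
      unfolding F_def by (auto intro!: derivative_eq_intros simp: power2_eq_square field_simps)
    then show "(F has_vector_derivative (\<alpha> + d * (t - (p + q) / 2))\<^sup>2) (at t within {p..q})"
      by (simp add: has_real_derivative_iff_has_vector_derivative)
  qed (use \<open>p < q\<close> in simp)
  \<comment> \<open>The mixed term of F takes the same value at both ends; the cubic one gives 2 ((q
    - p) / 2)^3 / 3, hence the 12.\<close>
  moreover have "F q - F p = \<alpha>\<^sup>2 * (q - p) + d\<^sup>2 * ((q - p) ^ 3 / 12)"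
    unfolding F_def by (simp add: power2_eq_square power3_eq_cube field_simps)
  ultimately have "((\<lambda>t. w t * w t) has_integral \<alpha>\<^sup>2 * (q - p) + d\<^sup>2 * ((q - p) ^ 3 / 12)) {p<..<q}"
    unfolding has_integral_Icc_iff_Ioo
    by (subst has_integral_cong[where g = "\<lambda>t. (\<alpha> + d * (t - (p + q) / 2))\<^sup>2"])
      (auto simp: w power2_eq_square)
  moreover have "((\<lambda>t. w t * w t) has_integral L2_inner w w) {0<..<1}"
    unfolding L2_inner_def using assms(4)
    by (intro has_integral_integral_lebesgue_on L2_mult_integrable) auto
  ultimately have "\<alpha>\<^sup>2 * (q - p) + d\<^sup>2 * ((q - p) ^ 3 / 12) \<le> L2_inner w w"
    by (rule has_integral_subset_le[rotated]) (use assms in auto)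
  moreover have "\<alpha>\<^sup>2 * (q - p) \<ge> 0"
    using assms by simp
  ultimately show ?thesis by linarith
qed

section \<open>Ramp sums on a fixed partition\<close>

context
  fixes N :: nat and x :: "nat \<Rightarrow> real"
  assumes part: "partition01 N x"
begin

lemma partition_less_Suc: "j < N \<Longrightarrow> x j < x (Suc j)"
  using part by (force simp: partition01_def dest: bspec[of _ _ "Suc j"])

lemma partition_mono: "i \<le> j \<Longrightarrow> j \<le> N \<Longrightarrow> x i \<le> x j"
proof (induction j rule: dec_induct)
  case (step j)
  then show ?case using partition_less_Suc[of j] by simp
qed simp

lemma partition_bounds:
  assumes "j \<le> N"
  shows "0 \<le> x j" "x j \<le> 1"
  using partition_mono[of 0 j] partition_mono[of j N] assms part by (auto simp: partition01_def)

lemma partition_cell: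
  assumes "t \<in> {0..1} - x ` {..N}"
  obtains j where "j < N" "t \<in> {x j<..<x (Suc j)}"
proof -
  have ends: "x 0 = 0" "x N = 1"
    using part by (auto simp: partition01_def)
  \<comment> \<open>First node beyond t. It has index at most N because t, not being a node, is less
    than \<open>x N\<close> = 1, and it is not 0 because \<open>x 0\<close> = 0 is at most
    t.\<close>
  define m where "m = (LEAST m. t < x m)"
  have "t < x N"
    using assms ends by (auto simp: image_iff less_le)
  then have m: "t < x m" "m \<le> N"
    unfolding m_def by (auto intro: LeastI Least_le)
  then obtain j where j: "m = Suc j"
    using assms ends by (cases m) auto
  have "\<not> t < x j"
    using not_less_Least[of j "\<lambda>m. t < x m"] j by (simp add: m_def)
  moreover have "t \<noteq> x j"
    using assms m j by auto
  ultimately show ?thesis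
    using m j by (intro that[of j]) auto
qed

lemma ramp_constant_off_cell:
  assumes "j < N" "i < N" "i \<noteq> j" "s \<in> {x j<..<x (Suc j)}" "t \<in> {x j<..<x (Suc j)}"
  shows "ramp (x i) (x (Suc i)) s = ramp (x i) (x (Suc i)) t"
proof -
  have "s \<in> {0..1}" "t \<in> {0..1}"
    using assms partition_bounds[of j] partition_bounds[of "Suc j"] by auto
  moreover have "x i \<le> x (Suc i)"
    using partition_less_Suc[of i] assms by simp
  moreover have "x (Suc i) \<le> x j \<or> x (Suc j) \<le> x i"
    using partition_mono[of "Suc i" j] partition_mono[of "Suc j" i] assms by (cases "i < j") auto
  ultimately show ?thesis
    using assms by (auto simp: ramp_def)
qed

text \<open>Inside a cell only its own ramp varies: those of later cells are still zero and those of
  earlier cells have reached their plateau. Relating two points avoids computing the plateau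
  values.\<close>

lemma ramp_sum_on_cell:
  assumes "j < N" "s \<in> {x j<..<x (Suc j)}" "t \<in> {x j<..<x (Suc j)}"
  shows "ramp_sum N x a t = ramp_sum N x a s + a j * (t - s)"
proof -
  have "s \<in> {0..1}" "t \<in> {0..1}"
    using assms partition_bounds[of j] partition_bounds[of "Suc j"] by auto
  then have "ramp (x j) (x (Suc j)) t - ramp (x j) (x (Suc j)) s = t - s"
    using assms by (auto simp: ramp_def)
  moreover have "ramp_sum N x a t - ramp_sum N x a s
      = (\<Sum>i<N. a i * (ramp (x i) (x (Suc i)) t - ramp (x i) (x (Suc i)) s))"
    by (simp add: ramp_sum_def sum_subtractf right_diff_distrib)
  moreover have "\<dots> = (\<Sum>i\<in>{j}. a i * (ramp (x i) (x (Suc i)) t - ramp (x i) (x (Suc i)) s))"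
    using assms ramp_constant_off_cell[of j _ s t] by (intro sum.mono_neutral_right) auto
  ultimately show ?thesis by simp
qed

lemma ramp_sum_has_derivative:
  assumes "t \<in> {0<..<1} - x ` {..N}"
  shows "(ramp_sum N x a has_real_derivative step_sum N x a t) (at t)"
  unfolding ramp_sum_def[abs_def] step_sum_def
proof (intro DERIV_sum DERIV_cmult ramp_has_derivative)
  fix j assume "j \<in> {..<N}"
  then show "x j < x (Suc j)" "t \<in> {0<..<1} - {x j, x (Suc j)}"
    using assms partition_less_Suc by auto
qed

lemma ramp_sum_has_weak_deriv: "has_weak_deriv (ramp_sum N x a) (step_sum N x a)"
  by (rule has_weak_deriv_piecewise[where K = "x ` {..N}"])
    (auto intro: continuous_on_ramp_sum step_sum_in_L2 ramp_sum_has_derivative)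

lemma ramp_sum_in_H1: "ramp_sum N x a \<in> H1"
  using ramp_sum_in_L2 step_sum_in_L2[of N x a] ramp_sum_has_weak_deriv[of a]
  unfolding H1_def by blast

text \<open>Inner products do not see null sets, so from here on the diffusion term can be computed
  with explicit step functions.\<close>

lemma weak_deriv_ramp_sum_inner:
  "L2_inner (weak_deriv (ramp_sum N x a)) (weak_deriv (ramp_sum N x b))
     = L2_inner (step_sum N x a) (step_sum N x b)"
  using weak_deriv_AE_eq[OF step_sum_in_L2 ramp_sum_has_weak_deriv]
  by (intro L2_inner_cong_AE step_sum_in_L2) auto

lemma ramp_sum_in_fe_space: "ramp_sum N x a \<in> fe_space N x"
  unfolding fe_space_def
proof (intro CollectI conjI ballI)
  show "ramp_sum N x a 0 = 0"
    unfolding ramp_sum_def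
  proof (intro sum.neutral ballI)
    fix j assume "j \<in> {..<N}"
    then have "x j < x (Suc j)" "0 \<le> x j"
      using partition_less_Suc partition_bounds by auto
    then show "a j * ramp (x j) (x (Suc j)) 0 = 0"
      by (simp add: ramp_def)
  qed
  fix j assume "j \<in> {1..N}"
  \<comment> \<open>\<open>fe_space\<close> numbers the cells from 1, \<open>ramp_sum\<close> from
    0.\<close>
  then obtain i where i: "j = Suc i" "i < N"
    by (cases j) auto
  define m where "m = (x i + x (Suc i)) / 2"
  have m: "m \<in> {x i<..<x (Suc i)}"
    using partition_less_Suc[OF i(2)] by (auto simp: m_def)
  show "\<exists>p. degree p \<le> 1 \<and> (\<forall>t\<in>{x (j - 1)<..<x j}. ramp_sum N x a t = poly p t)"
  proof (intro exI[of _ "[:ramp_sum N x a m - a i * m, a i:]"] conjI ballI)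
    fix t assume "t \<in> {x (j - 1)<..<x j}"
    then show "ramp_sum N x a t = poly [:ramp_sum N x a m - a i * m, a i:] t"
      using ramp_sum_on_cell[OF i(2) m, of t a] i by (simp add: algebra_simps)
  qed simp
qed (auto simp: continuous_on_ramp_sum, simp_all add: ramp_sum_def ramp_def)

text \<open>The difference of \<open>v\<close> and the ramp sum with the slopes of \<open>v\<close> has derivative zero off the
  nodes.\<close>

lemma fe_space_ramp_sum:
  assumes "v \<in> fe_space N x"
  obtains a where "v = ramp_sum N x a" "\<And>i. i \<ge> N \<Longrightarrow> a i = 0"
proof -
  have v: "continuous_on {0..1} v" "v 0 = 0" "\<And>t. t \<notin> {0..1} \<Longrightarrow> v t = 0"
    using assms by (auto simp: fe_space_def)
  have "\<exists>p. degree p \<le> 1 \<and> (\<forall>t\<in>{x j<..<x (Suc j)}. v t = poly p t)" if "j < N" for j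
    using assms that unfolding fe_space_def by (force dest: bspec[of _ _ "Suc j"])
  then obtain P where P: "\<And>j. j < N \<Longrightarrow> degree (P j) \<le> 1"
      "\<And>j t. j < N \<Longrightarrow> t \<in> {x j<..<x (Suc j)} \<Longrightarrow> v t = poly (P j) t"
    by metis
  \<comment> \<open>The slope is coefficient 1 and not the leading one, since v may be constant on a
    cell. Beyond N the value 0 is a normalisation.\<close>
  define a where "a = (\<lambda>j. if j < N then coeff (P j) 1 else 0)"
  define w where "w = (\<lambda>t. v t - ramp_sum N x a t)"
  have "w t = 0" if "t \<in> {0..1}" for t
  proof (rule has_derivative_zero_unique_strong_interval[where k = "x ` {..N}" and f = w])
    show "continuous_on {0..1} w"
      unfolding w_def using v continuous_on_ramp_sum by (intro continuous_intros)
    show "w 0 = 0"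
      using v ramp_sum_in_fe_space[of a] by (simp add: w_def fe_space_def)
    fix s assume "s \<in> {0..1} - x ` {..N}"
    then obtain j where j: "j < N" "s \<in> {x j<..<x (Suc j)}"
      using partition_cell by blast
    have "w t = w s" if t: "t \<in> {x j<..<x (Suc j)}" for t
    proof -
      have "P j = [:coeff (P j) 0, coeff (P j) 1:]"
        using P(1)[OF j(1)] by (intro poly_eqI) (auto simp: coeff_pCons coeff_eq_0 split: nat.split)
      then have "poly (P j) r = poly [:coeff (P j) 0, coeff (P j) 1:] r" for r
        by (rule arg_cong)
      also have "\<dots> r = coeff (P j) 0 + r * a j" for r
        using j(1) by (simp add: a_def)
      finally show ?thesis
        using P(2)[OF j(1) t] P(2)[OF j] ramp_sum_on_cell[OF j t, of a]
        by (simp add: w_def algebra_simps)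
    qed
    then have const: "w s = w t" if "t \<in> {x j<..<x (Suc j)}" for t
      using that by metis
    \<comment> \<open>On the open cell around s the slopes of v and of the ramp sum cancel, so w is
      constant there.\<close>
    have "(w has_derivative (\<lambda>h. 0)) (at s)"
      by (rule has_derivative_transform_within_open[OF has_derivative_const[of "w s"] _ j(2) const]) auto
    then show "(w has_derivative (\<lambda>h. 0)) (at s within {0..1})"
      by (rule has_derivative_at_withinI)
  qed (use that in auto)
  then have "v t = ramp_sum N x a t" for t
    using v(3)[of t] by (cases "t \<in> {0..1}") (auto simp: w_def ramp_sum_def ramp_def)
  then show ?thesis
    using that[of a] by (auto simp: a_def)
qed

text \<open>Each slope is controlled by the norm on its own cell, with the factor 12 / (cell
  length)^3. This converts monotonicity in L2 into strong monotonicity in the slopes; that C depends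
  on the mesh is harmless. The summand 1 makes C positive outright.\<close>

lemma sum_slopes_le_L2:
  obtains C where "C > 0"
    "\<And>a. (\<Sum>i<N. (a i)\<^sup>2) \<le> C * L2_inner (ramp_sum N x a) (ramp_sum N x a)"
proof
  define C where "C = (\<lambda>i. 12 / (x (Suc i) - x i) ^ 3)"
  have C: "C i \<ge> 0" if "i < N" for i
    using partition_less_Suc[OF that] by (simp add: C_def)
  then show "1 + (\<Sum>i<N. C i) > 0"
    by (intro add_pos_nonneg sum_nonneg) auto
  fix a
  let ?u = "ramp_sum N x a"
  have "(a i)\<^sup>2 \<le> C i * L2_inner ?u ?u" if "i < N" for i
  proof -
    let ?m = "(x i + x (Suc i)) / 2"
    have lt: "x i < x (Suc i)"
      by (rule partition_less_Suc[OF that])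
    have "(a i)\<^sup>2 * ((x (Suc i) - x i) ^ 3 / 12) \<le> L2_inner ?u ?u"
      using that lt partition_bounds[of i] partition_bounds[of "Suc i"]
      by (intro L2_inner_self_ge_slope[where \<alpha> = "?u ?m"] ramp_sum_in_L2 ramp_sum_on_cell) auto
    then show ?thesis
      using lt by (simp add: C_def field_simps)
  qed
  then have "(\<Sum>i<N. (a i)\<^sup>2) \<le> (\<Sum>i<N. C i) * L2_inner ?u ?u"
    unfolding sum_distrib_right by (intro sum_mono) auto
  then show "(\<Sum>i<N. (a i)\<^sup>2) \<le> (1 + (\<Sum>i<N. C i)) * L2_inner ?u ?u"
    using L2_inner_self_nonneg[of ?u] by (simp add: distrib_right)
qed

end

section \<open>The backward Euler scheme\<close>

lemma L2_inner_ramp_sum_right: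
  assumes "f \<in> L2"
  shows "L2_inner f (ramp_sum N x b) = (\<Sum>i<N. b i * L2_inner f (ramp (x i) (x (Suc i))))"
  unfolding ramp_sum_def[abs_def] using assms
  by (subst L2_inner_sum_right)
    (auto intro!: L2_cmult ramp_in_L2 sum.cong simp: L2_inner_commute[of f] L2_inner_cmult_left)

lemma L2_inner_step_sum_right:
  assumes "f \<in> L2"
  shows "L2_inner f (step_sum N x b) = (\<Sum>i<N. b i * L2_inner f (indicator {x i<..<x (Suc i)}))"
  unfolding step_sum_def[abs_def] using assms
  by (subst L2_inner_sum_right)
    (auto intro!: L2_cmult indicator_in_L2 sum.cong simp: L2_inner_commute[of f] L2_inner_cmult_left)

lemma continuous_on_L2_inner_ramp_sum:
  "w \<in> L2 \<Longrightarrow> continuous_on UNIV (\<lambda>a. L2_inner (ramp_sum N x a) w)"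
  by (simp add: L2_inner_commute[of _ w] L2_inner_ramp_sum_right)
    (intro continuous_intros continuous_on_product_coordinates)

lemma continuous_on_L2_inner_step_sum:
  "w \<in> L2 \<Longrightarrow> continuous_on UNIV (\<lambda>a. L2_inner (step_sum N x a) w)"
  by (simp add: L2_inner_commute[of _ w] L2_inner_step_sum_right)
    (intro continuous_intros continuous_on_product_coordinates)

text \<open>Expanding the cube gives a polynomial of degree 3 in finitely many coordinates, so no
  limit has to be taken under the integral.\<close>

lemma continuous_on_L2_inner_ramp_sum_cube:
  assumes "w \<in> L2"
  shows "continuous_on UNIV (\<lambda>a. L2_inner (\<lambda>t. (ramp_sum N x a t) ^ 3) w)"
proof -
  define r where "r = (\<lambda>j. ramp (x j) (x (Suc j)))"
  have L2: "(\<lambda>t. r i t * r j t * r l t) \<in> L2" for i j l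
    unfolding r_def by (intro L2_continuous continuous_intros continuous_on_ramp)
  have "L2_inner (\<lambda>t. (ramp_sum N x a t) ^ 3) w
      = (\<Sum>i<N. \<Sum>j<N. \<Sum>l<N. (a i * a j * a l) * L2_inner (\<lambda>t. r i t * r j t * r l t) w)" for a
  proof -
    have "(ramp_sum N x a t) ^ 3
        = (\<Sum>i<N. \<Sum>j<N. \<Sum>l<N. (a i * a j * a l) * (r i t * r j t * r l t))" for t
      by (simp add: ramp_sum_def power3_eq_cube sum_product sum_distrib_left sum_distrib_right
          r_def mult_ac)
    then show ?thesis
      using assms by (simp add: L2_inner_sum_left L2_inner_cmult_left L2_sum L2_cmult L2)
  qed
  then show ?thesis
    by (simp only:) (intro continuous_intros continuous_on_product_coordinates)
qed

section \<open>From a single time step to the whole sequence\<close>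

definition Euler_step ::
    "(real \<Rightarrow> real) set \<Rightarrow> ((real \<Rightarrow> real) \<Rightarrow> real \<Rightarrow> real) \<Rightarrow>
     real \<Rightarrow> real \<Rightarrow> real \<Rightarrow> real \<Rightarrow> real \<Rightarrow> (real \<Rightarrow> real) \<Rightarrow> (real \<Rightarrow> real) \<Rightarrow> bool" where
  "Euler_step S I \<nu> \<gamma> \<delta> \<mu> k z y \<longleftrightarrow> y \<in> S \<and>
     (\<forall>w\<in>S. L2_inner (\<lambda>t. (y t - z t) / k) w + \<nu> * L2_inner (weak_deriv y) (weak_deriv w)
        - \<gamma> * L2_inner y w + \<delta> * L2_inner (\<lambda>t. (y t) ^ 3) w = - \<mu> * L2_inner (I y) w)"

lemma backward_Euler_solution_ex1:
  assumes step: "\<And>z. z \<in> S \<Longrightarrow> \<exists>!y. Euler_step S I \<nu> \<gamma> \<delta> \<mu> k z y" and "y\<^sub>0 \<in> S"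
  shows "\<exists>!Y. backward_Euler_solution S I \<nu> \<gamma> \<delta> \<mu> k y\<^sub>0 Y"
proof -
  let ?step = "Euler_step S I \<nu> \<gamma> \<delta> \<mu> k"
  have sol: "backward_Euler_solution S I \<nu> \<gamma> \<delta> \<mu> k y\<^sub>0 Y \<longleftrightarrow>
      Y 0 = y\<^sub>0 \<and> (\<forall>n. ?step (Y n) (Y (Suc n)))" for Y
  proof -
    have "(\<forall>n\<ge>1. P n) \<longleftrightarrow> (\<forall>n. P (Suc n))" for P
      by (auto simp: Suc_le_eq gr0_conv_Suc)
    then show ?thesis
      unfolding backward_Euler_solution_def Euler_step_def by (simp only: diff_Suc_1)
  qed
  \<comment> \<open>The description \<open>THE\<close> is meaningful only for z in S, so membership
    of \<open>Y n\<close> in S has to be carried along the recursion.\<close>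
  define Y where "Y = rec_nat y\<^sub>0 (\<lambda>_ z. THE y. ?step z y)"
  have in_S: "?step z y \<Longrightarrow> y \<in> S" for z y
    by (simp add: Euler_step_def)
  have Y_step: "?step (Y n) (Y (Suc n))" if "Y n \<in> S" for n
    using theI'[OF step[OF that]] by (simp add: Y_def)
  have "Y n \<in> S" for n
    by (induction n) (use \<open>y\<^sub>0 \<in> S\<close> Y_step in_S in \<open>auto simp: Y_def\<close>)
  then have "Y 0 = y\<^sub>0 \<and> (\<forall>n. ?step (Y n) (Y (Suc n)))"
    using Y_step by (simp add: Y_def)
  moreover have "V = W" if V: "V 0 = y\<^sub>0 \<and> (\<forall>n. ?step (V n) (V (Suc n)))"
    and W: "W 0 = y\<^sub>0 \<and> (\<forall>n. ?step (W n) (W (Suc n)))" for V W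
  proof
    fix n
    have "V n = W n \<and> V n \<in> S"
    proof (induction n)
      case 0
      then show ?case using V W \<open>y\<^sub>0 \<in> S\<close> by simp
    next
      case (Suc n)
      then show ?case
        using step[of "V n"] V W in_S by (metis)
    qed
    then show "V n = W n" ..
  qed
  ultimately show ?thesis
    unfolding sol by blast
qed

section \<open>The interpolation operator on ramp sums\<close>

context
  fixes N :: nat and x :: "nat \<Rightarrow> real" and I :: "(real \<Rightarrow> real) \<Rightarrow> real \<Rightarrow> real"
    and c\<^sub>p h :: real
  assumes part: "partition01 N x" and interp: "interpolation_operator c\<^sub>p h I"
begin

lemma interpolant_in_L2: "I (ramp_sum N x a) \<in> L2"
  using interp ramp_sum_in_H1[OF part] by (auto simp: interpolation_operator_def)

lemma interpolant_linear:
  assumes "\<phi> \<in> H1" "\<psi> \<in> H1"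
  shows "AE t in leb01. I (\<lambda>t. a * \<phi> t + b * \<psi> t) t = a * I \<phi> t + b * I \<psi> t"
  using interp assms by (auto simp: interpolation_operator_def)

lemma interpolant_diff:
  "AE t in leb01. I (ramp_sum N x (\<lambda>i. a i - b i)) t = I (ramp_sum N x a) t - I (ramp_sum N x b) t"
  using interpolant_linear[OF ramp_sum_in_H1[OF part] ramp_sum_in_H1[OF part], of 1 a "-1" b]
  by (simp add: ramp_sum_diff)

text \<open>Squared, and with \<open>step_sum\<close> in place of the weak derivative inside
  \<open>H1_norm\<close>, the error bound has the form that the diffusion term can absorb.\<close>

lemma interpolation_error:
  "L2_inner (\<lambda>t. ramp_sum N x a t - I (ramp_sum N x a) t) (\<lambda>t. ramp_sum N x a t - I (ramp_sum N x a) t)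
     \<le> c\<^sub>p\<^sup>2 * h\<^sup>2 * (L2_inner (ramp_sum N x a) (ramp_sum N x a) + L2_inner (step_sum N x a) (step_sum N x a))"
proof -
  let ?u = "ramp_sum N x a"
  have "L2_norm (\<lambda>t. ?u t - I ?u t) \<le> c\<^sub>p * h * H1_norm ?u"
    using interp ramp_sum_in_H1[OF part] by (auto simp: interpolation_operator_def)
  then have "(L2_norm (\<lambda>t. ?u t - I ?u t))\<^sup>2 \<le> (c\<^sub>p * h * H1_norm ?u)\<^sup>2"
    by (rule power_mono) (simp add: L2_norm_def L2_inner_self_nonneg)
  moreover have "(H1_norm ?u)\<^sup>2 = L2_inner ?u ?u + L2_inner (step_sum N x a) (step_sum N x a)"
    by (simp add: H1_norm_def L2_norm_power2 L2_inner_self_nonneg weak_deriv_ramp_sum_inner[OF part])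
  ultimately show ?thesis
    by (simp add: L2_norm_power2 power_mult_distrib)
qed

text \<open>Linearity is given for two terms at a time and off a null set depending on them, so the
  slopes are switched on one by one and finitely many null sets are discarded.\<close>

lemma interpolant_ramp_sum:
  "AE t in leb01. I (ramp_sum N x a) t
     = (\<Sum>j<N. a j * I (ramp_sum N x (\<lambda>i. if i = j then 1 else 0)) t)"
proof -
  let ?e = "\<lambda>j i. if i = j then 1 else 0 :: real"
  let ?trunc = "\<lambda>n i. if i < n then a i else 0"
  have partial: "AE t in leb01. I (ramp_sum N x (?trunc n)) t
      = (\<Sum>j<n. a j * I (ramp_sum N x (?e j)) t)" for n
  proof (induction n)
    case 0
    \<comment> \<open>That I maps zero to zero almost everywhere is linearity with both scalars
      equal to 0.\<close>
    have "(\<lambda>t. 0 * ramp_sum N x a t + 0 * ramp_sum N x a t) = ramp_sum N x (?trunc 0)"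
      by (simp add: ramp_sum_def fun_eq_iff)
    then show ?case
      using interpolant_linear[OF ramp_sum_in_H1[OF part] ramp_sum_in_H1[OF part], of 0 a 0 a] by simp
  next
    case (Suc n)
    have "ramp_sum N x (?trunc (Suc n)) t
        = 1 * ramp_sum N x (?trunc n) t + a n * ramp_sum N x (?e n) t" for t
      unfolding ramp_sum_def sum_distrib_left sum.distrib[symmetric]
      by (intro sum.cong) (auto simp: less_Suc_eq)
    then have split: "ramp_sum N x (?trunc (Suc n))
        = (\<lambda>t. 1 * ramp_sum N x (?trunc n) t + a n * ramp_sum N x (?e n) t)"
      by (rule ext)
    show ?case
      unfolding split
      using Suc interpolant_linear[OF ramp_sum_in_H1[OF part] ramp_sum_in_H1[OF part],
          of 1 "?trunc n" "a n" "?e n"]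
      by eventually_elim simp
  qed
  have "ramp_sum N x (?trunc N) = ramp_sum N x a"
    by (simp add: ramp_sum_def fun_eq_iff)
  with partial[of N] show ?thesis by (simp only:)
qed

text \<open>On a finite-dimensional space linearity already gives continuity: this is a linear form
  in the N slopes.\<close>

lemma continuous_on_L2_inner_interpolant:
  assumes "w \<in> L2"
  shows "continuous_on UNIV (\<lambda>a. L2_inner (I (ramp_sum N x a)) w)"
proof -
  let ?e = "\<lambda>j i. if i = j then 1 else 0 :: real"
  have eq: "L2_inner (I (ramp_sum N x a)) w = (\<Sum>j<N. a j * L2_inner (I (ramp_sum N x (?e j))) w)" for a
  proof -
    have "L2_inner (I (ramp_sum N x a)) w
        = L2_inner (\<lambda>t. \<Sum>j<N. a j * I (ramp_sum N x (?e j)) t) w"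
      using assms interpolant_ramp_sum
      by (intro L2_inner_cong_AE interpolant_in_L2 L2_sum L2_cmult) auto
    then show ?thesis
      using assms by (simp add: L2_inner_sum_left L2_inner_cmult_left L2_cmult interpolant_in_L2)
  qed
  have "continuous_on UNIV (\<lambda>a. \<Sum>j<N. a j * L2_inner (I (ramp_sum N x (?e j))) w)"
    by (intro continuous_intros continuous_on_product_coordinates)
  then show ?thesis
    by (rule continuous_on_eq) (rule eq[symmetric])
qed

section \<open>Unique solvability of one step\<close>

context
  fixes \<nu> \<gamma> \<delta> \<mu> k :: real
  assumes pos: "\<nu> > 0" "\<gamma> > 0" "\<delta> > 0" "\<mu> > 0" "k > 0"
    and \<nu>_ge: "\<nu> \<ge> \<mu> * c\<^sub>p\<^sup>2 * h\<^sup>2 / 2" and \<mu>_ge: "\<mu> \<ge> 2 * (\<gamma> + \<nu>)"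
begin

text \<open>Everything in the step except diffusion, with the control term moved to the left-hand
  side, as one L2 function; this allows monotonicity to be proved pointwise under the
  integral.\<close>

definition reaction :: "(real \<Rightarrow> real) \<Rightarrow> (nat \<Rightarrow> real) \<Rightarrow> real \<Rightarrow> real" where
  "reaction z a t = (ramp_sum N x a t - z t) / k - \<gamma> * ramp_sum N x a t
     + \<delta> * (ramp_sum N x a t) ^ 3 + \<mu> * I (ramp_sum N x a) t"

text \<open>The step equation tested with the i-th ramp, whose derivative is the indicator:
  component i of the map G of the overview.\<close>

definition residual :: "(real \<Rightarrow> real) \<Rightarrow> (nat \<Rightarrow> real) \<Rightarrow> nat \<Rightarrow> real" where
  "residual z a i = L2_inner (reaction z a) (ramp (x i) (x (Suc i)))
     + \<nu> * L2_inner (step_sum N x a) (indicator {x i<..<x (Suc i)})"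

lemma reaction_in_L2: "z \<in> L2 \<Longrightarrow> reaction z a \<in> L2"
  unfolding reaction_def[abs_def]
  by (intro L2_add L2_diff L2_cmult L2_divide ramp_sum_cube_in_L2 ramp_sum_in_L2 interpolant_in_L2)

lemma L2_inner_reaction:
  assumes "z \<in> L2" "w \<in> L2"
  shows "L2_inner (reaction z a) w = L2_inner (\<lambda>t. (ramp_sum N x a t - z t) / k) w
     - \<gamma> * L2_inner (ramp_sum N x a) w + \<delta> * L2_inner (\<lambda>t. (ramp_sum N x a t) ^ 3) w
     + \<mu> * L2_inner (I (ramp_sum N x a)) w"
proof -
  define f g u v where "f = (\<lambda>t. (ramp_sum N x a t - z t) / k)" and "g = ramp_sum N x a"
    and "u = (\<lambda>t. (ramp_sum N x a t) ^ 3)" and "v = I (ramp_sum N x a)"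
  have L2: "f \<in> L2" "g \<in> L2" "u \<in> L2" "v \<in> L2"
    unfolding f_def g_def u_def v_def
    by (intro L2_divide L2_diff ramp_sum_in_L2 ramp_sum_cube_in_L2 interpolant_in_L2 assms(1))+
  have "reaction z a = (\<lambda>t. f t - \<gamma> * g t + \<delta> * u t + \<mu> * v t)"
    by (simp add: reaction_def fun_eq_iff f_def g_def u_def v_def)
  then have "L2_inner (reaction z a) w
      = L2_inner f w - \<gamma> * L2_inner g w + \<delta> * L2_inner u w + \<mu> * L2_inner v w"
    using assms(2) L2
    by (simp add: L2_inner_add_left L2_inner_diff_left L2_inner_cmult_left L2_add L2_diff L2_cmult)
  then show ?thesis
    by (simp only: f_def g_def u_def v_def)
qed

text \<open>The equation is linear in its test function. This links the coordinate pairing of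
  \<open>strongly_monotone_zero\<close> with the L2 pairing of the scheme.\<close>

lemma sum_residual:
  assumes "z \<in> L2"
  shows "(\<Sum>i<N. residual z a i * b i)
     = L2_inner (reaction z a) (ramp_sum N x b) + \<nu> * L2_inner (step_sum N x a) (step_sum N x b)"
proof -
  have "residual z a i * b i = b i * L2_inner (reaction z a) (ramp (x i) (x (Suc i)))
      + \<nu> * (b i * L2_inner (step_sum N x a) (indicator {x i<..<x (Suc i)}))" for i
    unfolding residual_def by (rule distrib_right[THEN trans]) (simp only: ac_simps)
  then show ?thesis
    by (simp only: sum.distrib sum_distrib_left[symmetric] L2_inner_step_sum_right[OF step_sum_in_L2]
        L2_inner_ramp_sum_right[OF reaction_in_L2[OF assms]])
qed

lemma Euler_step_iff_residual:
  assumes "z \<in> L2"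
  shows "Euler_step (fe_space N x) I \<nu> \<gamma> \<delta> \<mu> k z (ramp_sum N x a) \<longleftrightarrow> (\<forall>i<N. residual z a i = 0)"
proof -
  have "Euler_step (fe_space N x) I \<nu> \<gamma> \<delta> \<mu> k z (ramp_sum N x a)
      \<longleftrightarrow> (\<forall>b. (\<Sum>i<N. residual z a i * b i) = 0)"
  proof -
    have eq: "(L2_inner (\<lambda>t. (ramp_sum N x a t - z t) / k) (ramp_sum N x b)
        + \<nu> * L2_inner (weak_deriv (ramp_sum N x a)) (weak_deriv (ramp_sum N x b))
        - \<gamma> * L2_inner (ramp_sum N x a) (ramp_sum N x b)
        + \<delta> * L2_inner (\<lambda>t. (ramp_sum N x a t) ^ 3) (ramp_sum N x b)
        = - \<mu> * L2_inner (I (ramp_sum N x a)) (ramp_sum N x b))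
        \<longleftrightarrow> (\<Sum>i<N. residual z a i * b i) = 0" for b
      unfolding sum_residual[OF assms] L2_inner_reaction[OF assms ramp_sum_in_L2]
        weak_deriv_ramp_sum_inner[OF part] by linarith
    have "fe_space N x = range (ramp_sum N x)"
      using ramp_sum_in_fe_space[OF part] by (auto elim: fe_space_ramp_sum[OF part])
    then show ?thesis
      unfolding Euler_step_def by (simp only: ball_simps eq) simp
  qed
  also have "\<dots> \<longleftrightarrow> (\<forall>i<N. residual z a i = 0)"
  proof (intro iffI allI impI)
    fix j assume "\<forall>b. (\<Sum>i<N. residual z a i * b i) = 0" "j < N"
    \<comment> \<open>A unit coefficient vector, that is a single ramp as test function, isolates
      one component.\<close>
    from this(1)[rule_format, of "\<lambda>i. if i = j then 1 else 0"] this(2)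
    show "residual z a j = 0"
      by (simp add: if_distrib cong: if_cong)
  qed simp
  finally show ?thesis .
qed

lemma residual_continuous:
  assumes "z \<in> L2"
  shows "continuous_on UNIV (\<lambda>a. residual z a i)"
proof -
  let ?r = "ramp (x i) (x (Suc i))"
  have "L2_inner (\<lambda>t. (ramp_sum N x a t - z t) / k) ?r
      = (1 / k) * (L2_inner (ramp_sum N x a) ?r - L2_inner z ?r)" for a
    using L2_inner_cmult_left[of "1 / k" "\<lambda>t. ramp_sum N x a t - z t" ?r]
    by (simp add: L2_inner_diff_left ramp_sum_in_L2 ramp_in_L2 assms)
  then show ?thesis
    unfolding residual_def L2_inner_reaction[OF assms ramp_in_L2]
    by (simp only:) (intro continuous_intros continuous_on_L2_inner_ramp_sum
      continuous_on_L2_inner_ramp_sum_cube continuous_on_L2_inner_interpolant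
      continuous_on_L2_inner_step_sum ramp_in_L2 indicator_in_L2)
qed

text \<open>The inequality holds at almost every point and is then integrated; the old value z
  cancels in the difference. The interpolation error stays on the left because its bound involves
  the derivative and is available only after integration.\<close>

lemma reaction_monotone:
  fixes a b :: "nat \<Rightarrow> real"
  assumes "z \<in> L2"
  defines "d \<equiv> ramp_sum N x (\<lambda>i. a i - b i)"
  shows "(1 / k - \<gamma> + \<mu> / 2) * L2_inner d d - \<mu> / 2 * L2_inner (\<lambda>t. d t - I d t) (\<lambda>t. d t - I d t)
     \<le> L2_inner (\<lambda>t. reaction z a t - reaction z b t) d"
proof -
  have L2: "d \<in> L2" "(\<lambda>t. d t - I d t) \<in> L2" "(\<lambda>t. reaction z a t - reaction z b t) \<in> L2"
    unfolding d_def by (intro L2_diff ramp_sum_in_L2 interpolant_in_L2 reaction_in_L2 assms(1))+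
  have "(LINT t|leb01. (1 / k - \<gamma> + \<mu> / 2) * (d t * d t) - \<mu> / 2 * ((d t - I d t) * (d t - I d t)))
      \<le> (LINT t|leb01. (reaction z a t - reaction z b t) * d t)"
  proof (rule integral_mono_AE)
    show "AE t in leb01. (1 / k - \<gamma> + \<mu> / 2) * (d t * d t) - \<mu> / 2 * ((d t - I d t) * (d t - I d t))
        \<le> (reaction z a t - reaction z b t) * d t"
      using interpolant_diff[of a b]
    proof eventually_elim
      case (elim t)
      define p q e where "p = ramp_sum N x a t" and "q = ramp_sum N x b t" and "e = I d t"
      have d: "d t = p - q" and e: "I (ramp_sum N x a) t = e + I (ramp_sum N x b) t"
        using elim by (simp_all add: d_def ramp_sum_diff p_def q_def e_def)
      \<comment> \<open>Completing the square in p^2 + p q + q^2 displays it as nonnegative.\<close>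
      have "p ^ 3 - q ^ 3 = (p - q) * ((p + q / 2)\<^sup>2 + 3 / 4 * q\<^sup>2)"
        by (simp add: power2_eq_square power3_eq_cube field_simps)
      then have "(p ^ 3 - q ^ 3) * (p - q) = (p - q)\<^sup>2 * ((p + q / 2)\<^sup>2 + 3 / 4 * q\<^sup>2)"
        by (simp add: power2_eq_square)
      then have cube: "\<delta> * ((p ^ 3 - q ^ 3) * (p - q)) \<ge> 0"
        using pos by simp
      have "(reaction z a t - reaction z b t) * d t
          = (1 / k - \<gamma>) * (p - q)\<^sup>2 + \<delta> * ((p ^ 3 - q ^ 3) * (p - q)) + \<mu> * (e * (p - q))"
        unfolding reaction_def d e p_def[symmetric] q_def[symmetric]
        by (simp add: power2_eq_square algebra_simps diff_divide_distrib)
      \<comment> \<open>Young's inequality in exact form: polarisation of e (p - q). Dropping the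
        square of e then gives the bound.\<close>
      moreover have "\<mu> * (e * (p - q)) = \<mu> / 2 * (p - q)\<^sup>2 - \<mu> / 2 * (p - q - e)\<^sup>2 + \<mu> / 2 * e\<^sup>2"
        by (simp add: power2_eq_square field_simps)
      moreover have "\<mu> / 2 * e\<^sup>2 \<ge> 0"
        using pos by simp
      ultimately show ?case
        using cube unfolding d e_def[symmetric] by (simp add: power2_eq_square distrib_right)
    qed
  qed (intro Bochner_Integration.integrable_diff integrable_mult_right L2_mult_integrable L2)+
  also have "(LINT t|leb01. (1 / k - \<gamma> + \<mu> / 2) * (d t * d t) - \<mu> / 2 * ((d t - I d t) * (d t - I d t)))
      = (1 / k - \<gamma> + \<mu> / 2) * L2_inner d d - \<mu> / 2 * L2_inner (\<lambda>t. d t - I d t) (\<lambda>t. d t - I d t)"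
    unfolding L2_inner_def
    by (subst Bochner_Integration.integral_diff)
      (simp_all only: integral_mult_right_zero integrable_mult_right L2_mult_integrable L2)
  finally show ?thesis
    by (simp only: L2_inner_def)
qed

lemma residual_strongly_monotone:
  assumes "z \<in> L2"
  shows "1 / k * L2_inner (ramp_sum N x (\<lambda>i. a i - b i)) (ramp_sum N x (\<lambda>i. a i - b i))
     \<le> (\<Sum>i<N. (residual z a i - residual z b i) * (a i - b i))"
proof -
  define d s where "d = ramp_sum N x (\<lambda>i. a i - b i)" and "s = step_sum N x (\<lambda>i. a i - b i)"
  define U V where "U = L2_inner d d" and "V = L2_inner s s"
  define E where "E = L2_inner (\<lambda>t. d t - I d t) (\<lambda>t. d t - I d t)"
  have UV: "U \<ge> 0" "V \<ge> 0"
    by (simp_all add: U_def V_def L2_inner_self_nonneg)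
  have "E \<le> c\<^sub>p\<^sup>2 * h\<^sup>2 * (U + V)"
    unfolding E_def U_def V_def d_def s_def by (rule interpolation_error)
  then have "\<mu> / 2 * E \<le> \<mu> / 2 * (c\<^sub>p\<^sup>2 * h\<^sup>2 * (U + V))"
    using pos by simp
  also have "\<dots> = \<mu> * c\<^sub>p\<^sup>2 * h\<^sup>2 / 2 * (U + V)"
    by simp
  \<comment> \<open>The first parameter condition enters here; the part \<nu> V will cancel against
    diffusion.\<close>
  also have "\<dots> \<le> \<nu> * (U + V)"
    using \<nu>_ge UV by (intro mult_right_mono) auto
  finally have E: "\<mu> / 2 * E \<le> \<nu> * U + \<nu> * V"
    by (simp add: distrib_left)
  have "(\<Sum>i<N. (residual z a i - residual z b i) * (a i - b i))
      = (\<Sum>i<N. residual z a i * (a i - b i)) - (\<Sum>i<N. residual z b i * (a i - b i))"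
    by (simp add: left_diff_distrib sum_subtractf)
  also have "\<dots> = L2_inner (\<lambda>t. reaction z a t - reaction z b t) d
      + \<nu> * (L2_inner (step_sum N x a) s - L2_inner (step_sum N x b) s)"
    unfolding sum_residual[OF assms] d_def s_def
    by (simp add: L2_inner_diff_left reaction_in_L2 assms ramp_sum_in_L2 right_diff_distrib)
  also have "L2_inner (step_sum N x a) s - L2_inner (step_sum N x b) s = V"
    unfolding V_def s_def by (subst (3) step_sum_diff) (simp add: L2_inner_diff_left step_sum_in_L2)
  finally have sum: "(\<Sum>i<N. (residual z a i - residual z b i) * (a i - b i))
      = L2_inner (\<lambda>t. reaction z a t - reaction z b t) d + \<nu> * V" .
  have "(1 / k - \<gamma> + \<mu> / 2) * U - \<mu> / 2 * E \<le> L2_inner (\<lambda>t. reaction z a t - reaction z b t) d"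
    unfolding U_def E_def d_def by (rule reaction_monotone[OF assms])
  \<comment> \<open>The second parameter condition: half of \<mu> outweighs both \<gamma> and the
    remaining part \<nu> U of the error.\<close>
  moreover have "\<nu> * U \<le> (\<mu> / 2 - \<gamma>) * U"
    using \<mu>_ge UV by (intro mult_right_mono) auto
  ultimately show ?thesis
    unfolding sum d_def[symmetric] U_def[symmetric]
    using E by (simp add: algebra_simps)
qed

lemma Euler_step_ex1:
  assumes "z \<in> fe_space N x"
  shows "\<exists>!y. Euler_step (fe_space N x) I \<nu> \<gamma> \<delta> \<mu> k z y"
proof -
  have z: "z \<in> L2"
    using assms by (auto simp: fe_space_def intro: L2_continuous)
  obtain C where C: "C > 0"
    "\<And>a. (\<Sum>i<N. (a i)\<^sup>2) \<le> C * L2_inner (ramp_sum N x a) (ramp_sum N x a)"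
    using sum_slopes_le_L2[OF part] by blast
  \<comment> \<open>The rate 1 / (k C) combines 1 / k from the time difference with the constant C
    that compares slopes with the L2 norm.\<close>
  have mono: "1 / (k * C) * (\<Sum>i<N. (a i - b i)\<^sup>2)
      \<le> (\<Sum>i<N. (residual z a i - residual z b i) * (a i - b i))" for a b
  proof -
    let ?d = "ramp_sum N x (\<lambda>i. a i - b i)"
    have "1 / (k * C) * (\<Sum>i<N. (a i - b i)\<^sup>2) \<le> 1 / (k * C) * (C * L2_inner ?d ?d)"
      using C pos by (intro mult_left_mono) auto
    also have "\<dots> = 1 / k * L2_inner ?d ?d"
      using C by simp
    also have "\<dots> \<le> (\<Sum>i<N. (residual z a i - residual z b i) * (a i - b i))"
      by (rule residual_strongly_monotone[OF z])
    finally show ?thesis .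
  qed
  \<comment> \<open>Entries from N on do not enter \<open>ramp_sum\<close>; they are frozen at 0.
    For the same reason uniqueness below compares slopes only for i < N.\<close>
  have "\<exists>a. (\<forall>i\<ge>N. a i = 0) \<and> (\<forall>i<N. residual z a i = 0)"
    by (rule strongly_monotone_zero[where c = "1 / (k * C)"])
      (use C pos mono residual_continuous[OF z] in auto)
  then obtain a where "\<forall>i<N. residual z a i = 0"
    by blast
  then have a: "Euler_step (fe_space N x) I \<nu> \<gamma> \<delta> \<mu> k z (ramp_sum N x a)"
    by (simp add: Euler_step_iff_residual[OF z])
  show ?thesis
  proof (rule ex1I, rule a)
    fix y assume y: "Euler_step (fe_space N x) I \<nu> \<gamma> \<delta> \<mu> k z y"
    then obtain b where b: "y = ramp_sum N x b"
      using fe_space_ramp_sum[OF part] by (metis Euler_step_def)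
    have "\<forall>i<N. residual z b i = 0" "\<forall>i<N. residual z a i = 0"
      using y a by (simp_all add: b Euler_step_iff_residual[OF z])
    then have "1 / (k * C) * (\<Sum>i<N. (b i - a i)\<^sup>2) \<le> 0"
      using mono[of b a] by simp
    moreover have "1 / (k * C) > 0"
      using C pos by simp
    ultimately have "(\<Sum>i<N. (b i - a i)\<^sup>2) \<le> 0"
      by (auto simp: divide_le_0_iff)
    then have "(\<Sum>i<N. (b i - a i)\<^sup>2) = 0"
      by (intro antisym sum_nonneg) auto
    then have "b i = a i" if "i < N" for i
      using that by (simp add: sum_nonneg_eq_0_iff)
    then show "y = ramp_sum N x a"
      by (simp add: b ramp_sum_def fun_eq_iff)
  qed
qed

end

end

theorem theorem4p3:
  fixes \<nu> \<gamma> \<delta> \<mu> c\<^sub>p h k :: real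
    and N :: nat and x :: "nat \<Rightarrow> real"
    and I\<^sub>h :: "(real \<Rightarrow> real) \<Rightarrow> real \<Rightarrow> real"
    and y\<^sub>0\<^sub>h :: "real \<Rightarrow> real"
  assumes "\<nu> > 0" and "\<gamma> > 0" and "\<delta> > 0" and "\<mu> > 0"
    and "partition01 N x" and "h = mesh_size N x" and "h > 0"
    and "interpolation_operator c\<^sub>p h I\<^sub>h"
    and "\<nu> \<ge> \<mu> * c\<^sub>p\<^sup>2 * h\<^sup>2 / 2" and "\<mu> \<ge> 2 * (\<gamma> + \<nu>)"
    and "y\<^sub>0\<^sub>h \<in> fe_space N x" and "k > 0"
  shows "\<exists>!Y. backward_Euler_solution (fe_space N x) I\<^sub>h \<nu> \<gamma> \<delta> \<mu> k y\<^sub>0\<^sub>h Y"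
  using assms by (intro backward_Euler_solution_ex1 Euler_step_ex1[where c\<^sub>p = c\<^sub>p and h = h]) auto

end
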